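(* For each $n\ge 1$ let $X_n=[x^n_{i,j}]_{i,j=1}^n$ be a Hermitian or real symmetric random matrix and let $D_n=\operatorname{diag}(a_n(1),\ldots,a_n(n))$ be a deterministic real diagonal matrix. Assume: (a) the entries $x^n_{i,j}$ of $X_n$ are independent (up to symmetry), centered, Gaussian, with variance denoted by $\sigma_n^2(i,j)$; (b) there are a bounded function $\sigma$ on $[0,1]\times[0,1]$ and a bounded real function $f$ on $[0,1]$ such that, as $n\to\infty$, in the $L^\infty$ topology, $\sigma_n^2(\lfloor nx\rfloor,\lfloor ny\rfloor)\to\sigma^2(x,y)$ and $a_n(\lfloor nx\rfloor)\to f(x)$; (c) the set of discontinuities of $\sigma$ is closed and intersects any vertical line of the square $[0,1]^2$ a finite number of times; (d) the push-forward $\mu$ of the uniform measure on $[0,1]$ by $f$ has a density $\rho$ with respect to Lebesgue measure on $\mathbb{R}$; (e) there exists a symmetric function $\tau(\cdot,\cdot)$ such that $\sigma^2(x,y)=\tau(f(x),f(y))$ for all $x,y\in[0,1]$; (f) there exist $\eta_0>0$, $\alpha>0$ and $C<\infty$ such that for almost all $s\in\mathbb{R}$ and all $t\in[s-\eta_0,s+\eta_0]$, $$|\tau(s,t)\rho(t)-\tau(s,s)\rho(s)|\le C|t-s|^\alpha .$$ For $\varepsilon\ge 0$, let $\mu_\varepsilon$ be the limit, as $n\to\infty$, of the spectral distribution of $D_n^\varepsilon=D_n+\sqrt{\varepsilon/n}\,X_n$ (see the context for its characterization). Define $$F(s):=-\rho(s)\,H[\tau(s,\cdot)\rho(\cdot)](s),$$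 where $H$ denotes the Hilbert transform (see the context for its normalization). Then for every function $g$ of the form $g(t)=\frac{1}{z-t}$ with $z\in\mathbb{C}$, $\Im z>0$, as $\varepsilon\to 0$, $$\int g(s)\,d\mu_\varepsilon(s)=\int g(s)\,d\mu(s)-\varepsilon\int g'(s)F(s)\,ds+o(\varepsilon).$$ As a consequence, if $F$ has bounded variation, then $\mu_\varepsilon=\mu+\varepsilon\,dF+o(\varepsilon)$, i.e. for every such $g$, as $\varepsilon\to0$, $$\int g\,d\mu_\varepsilon=\int g\,d\mu+\varepsilon\int g\,dF+o(\varepsilon).$$
   Context: Spectral distribution: the spectral distribution of an $n\times n$ Hermitian matrix is the uniform probability measure on its $n$ eigenvalues, counted with multiplicity. Characterization of $\mu_\varepsilon$ (known result of Shlyakhtenko, to be taken as given): under (a), (b), (c), as $n\to\infty$ the spectral distribution of $D_n^\varepsilon$ tends to a probability measure $\mu_\varepsilon$ on $\mathbb{R}$ whose Cauchy transform $C_\varepsilon(z)=\int\frac{d\mu_\varepsilon(t)}{z-t}$, for $z\in\mathbb{C}^+=\{z:\Im z>0\}$, is given by $$C_\varepsilon(z)=\int_0^1 C_\varepsilon(x,z)\,dx,$$ where, for $x\in[0,1]$, $C_\varepsilon(x,\cdot)$ is analytic, maps the upper half-plane $\mathbb{C}^+$ into the lower half-plane $\mathbb{C}^-$, and these functions are determined by the relation $$C_\varepsilon(x,z)=\frac{1}{z-f(x)-\varepsilon\int_0^1\sigma^2(x,y)\,C_\varepsilon(y,z)\,dy}.$$ Hilbert transform: for a function $u$ on $\mathbb{R}$,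 $$H[u](s):=\operatorname{p.v.}\int_{\mathbb{R}}\frac{u(t)}{s-t}\,dt=\lim_{\eta\to0^+}\int_{|s-t|>\eta}\frac{u(t)}{s-t}\,dt$$ (there is no factor $1/\pi$). In $H[\tau(s,\cdot)\rho(\cdot)](s)$ the transform is applied to the function $t\mapsto\tau(s,t)\rho(t)$ with $s$ fixed and is then evaluated at the same point $s$. Under the hypotheses, $s\mapsto\rho(s)H[\tau(s,\cdot)\rho(\cdot)](s)$ is well defined (for almost every $s$) and compactly supported. $dF$ denotes the (signed) Stieltjes measure of the function $F$ of bounded variation, i.e. its distributional derivative. *)

theory Defs
  imports "HOL-Probability.Probability" "Jordan_Normal_Form.Char_Poly"
begin

definition centered_gaussian :: "'w measure \<Rightarrow> ('w \<Rightarrow> real) \<Rightarrow> real \<Rightarrow> bool" where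
  "centered_gaussian M Y v \<longleftrightarrow> 0 \<le> v \<and> Y \<in> borel_measurable M \<and>
     distr M borel Y =
       (if v = 0 then return borel 0
        else density lborel (\<lambda>t. ennreal (normal_density 0 (sqrt v) t)))"

text \<open>A complex variable is centered Gaussian when it is so as a vector of \<open>\<real>\<^sup>2\<close>, that is, when every
  real-linear functional of it is a (possibly degenerate) centered real Gaussian. No relation
  between real and imaginary part is imposed: real Gaussians are the case of zero imaginary part.\<close>

definition centered_complex_gaussian :: "'w measure \<Rightarrow> ('w \<Rightarrow> complex) \<Rightarrow> real \<Rightarrow> bool" where
  "centered_complex_gaussian M Z v \<longleftrightarrow> Z \<in> borel_measurable M \<and>
     (\<forall>w. \<exists>u. centered_gaussian M (\<lambda>\<omega>. Re (w * Z \<omega>)) u) \<and>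
     (LINT \<omega>|M. (cmod (Z \<omega>))\<^sup>2) = v"

text \<open>Entries are indexed by \<open>{1..n}\<close>. Real symmetric matrices are the Hermitian ones with real
  entries, so both symmetry classes are covered.\<close>

definition gaussian_hermitian ::
  "'w measure \<Rightarrow> nat \<Rightarrow> (nat \<Rightarrow> nat \<Rightarrow> 'w \<Rightarrow> complex) \<Rightarrow> (nat \<Rightarrow> nat \<Rightarrow> real) \<Rightarrow> bool" where
  "gaussian_hermitian M n X v \<longleftrightarrow> prob_space M \<and>
     (\<forall>i\<in>{1..n}. \<forall>j\<in>{1..n}. \<forall>\<omega>\<in>space M. X j i \<omega> = cnj (X i j \<omega>)) \<and>
     prob_space.indep_vars M (\<lambda>_. borel) (\<lambda>(i, j). X i j) {(i, j). 1 \<le> i \<and> i \<le> j \<and> j \<le> n} \<and>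
     (\<forall>i\<in>{1..n}. \<forall>j\<in>{1..n}. centered_complex_gaussian M (X i j) (v i j))"

text \<open>The matrix \<open>diag(a(1),\<dots>,a(n)) + sqrt(\<epsilon>/n) X\<close>; the library's matrices are indexed from 0.\<close>

definition perturbed_matrix ::
  "nat \<Rightarrow> (nat \<Rightarrow> real) \<Rightarrow> (nat \<Rightarrow> nat \<Rightarrow> complex) \<Rightarrow> real \<Rightarrow> complex mat" where
  "perturbed_matrix n a X \<epsilon> = mat n n (\<lambda>(i, j).
     (if i = j then complex_of_real (a (Suc i)) else 0)
       + complex_of_real (sqrt (\<epsilon> / real n)) * X (Suc i) (Suc j))"

text \<open>Meant for Hermitian matrices of positive size, whose eigenvalues are real.\<close>

definition spectral_distribution :: "complex mat \<Rightarrow> real measure" where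
  "spectral_distribution A =
     distr (measure_pmf (pmf_of_multiset (image_mset Re (proots (char_poly A))))) borel (\<lambda>t. t)"

text \<open>Weak convergence, in probability, of random measures to a deterministic measure. The
  probability space may depend on \<open>n\<close>.\<close>

definition tends_weakly_in_prob ::
  "(nat \<Rightarrow> 'w measure) \<Rightarrow> (nat \<Rightarrow> 'w \<Rightarrow> real measure) \<Rightarrow> real measure \<Rightarrow> bool" where
  "tends_weakly_in_prob M L \<nu> \<longleftrightarrow>
     (\<forall>h :: real \<Rightarrow> real. continuous_on UNIV h \<and> bounded (range h) \<longrightarrow>
       (\<forall>\<delta>>0. (\<lambda>n. measure (M n)
          {\<omega> \<in> space (M n). \<bar>(LINT t|L n \<omega>. h t) - (LINT t|\<nu>. h t)\<bar> > \<delta>}) \<longlonglongrightarrow> 0))"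

definition Linf_dist :: "'a::euclidean_space set \<Rightarrow> ('a \<Rightarrow> real) \<Rightarrow> ('a \<Rightarrow> real) \<Rightarrow> ereal" where
  "Linf_dist S u v = esssup (lebesgue_on S) (\<lambda>x. ereal \<bar>u x - v x\<bar>)"

text \<open>On \<open>[0, 1/n)\<close> the index \<open>\<lfloor>nx\<rfloor> = 0\<close> is not a row of an \<open>n \<times> n\<close> matrix, so the \<open>L\<^sup>\<infinity>\<close>
  distance is taken over \<open>[1/n, 1]\<close>. This asks for less than any extension of the profile to index 0.\<close>

definition profile_converges1 :: "(nat \<Rightarrow> nat \<Rightarrow> real) \<Rightarrow> (real \<Rightarrow> real) \<Rightarrow> bool" where
  "profile_converges1 a f \<longleftrightarrow>
     (\<lambda>n. Linf_dist {1 / real n..1} (\<lambda>x. a n (nat \<lfloor>real n * x\<rfloor>)) f) \<longlonglongrightarrow> 0"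

definition profile_converges2 ::
  "(nat \<Rightarrow> nat \<Rightarrow> nat \<Rightarrow> real) \<Rightarrow> (real \<Rightarrow> real \<Rightarrow> real) \<Rightarrow> bool" where
  "profile_converges2 v w \<longleftrightarrow>
     (\<lambda>n. Linf_dist ({1 / real n..1} \<times> {1 / real n..1})
        (\<lambda>(x, y). v n (nat \<lfloor>real n * x\<rfloor>) (nat \<lfloor>real n * y\<rfloor>)) (\<lambda>(x, y). w x y)) \<longlonglongrightarrow> 0"

definition discontinuities :: "(real \<Rightarrow> real \<Rightarrow> real) \<Rightarrow> (real \<times> real) set" where
  "discontinuities \<sigma> =
     {p \<in> {0..1} \<times> {0..1}. \<not> continuous (at p within {0..1} \<times> {0..1}) (\<lambda>(x, y). \<sigma> x y)}"

definition cauchy_kernel :: "complex \<Rightarrow> real \<Rightarrow> complex" where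
  "cauchy_kernel z t = 1 / (z - complex_of_real t)"

text \<open>The characterization of the limit law: \<open>C x z\<close> is \<open>C\<^sub>\<epsilon>(x,z)\<close>.
  Measurability in \<open>x\<close> is what gives the integrals over \<open>[0,1]\<close> a meaning.\<close>

definition has_shlyakhtenko_transform ::
  "(real \<Rightarrow> real \<Rightarrow> real) \<Rightarrow> (real \<Rightarrow> real) \<Rightarrow> real \<Rightarrow> real measure \<Rightarrow> bool" where
  "has_shlyakhtenko_transform \<sigma> f \<epsilon> \<nu> \<longleftrightarrow>
     (\<exists>C :: real \<Rightarrow> complex \<Rightarrow> complex.
        (\<forall>z. Im z > 0 \<longrightarrow> (\<lambda>x. C x z) \<in> borel_measurable (lebesgue_on {0..1})) \<and>
        (\<forall>x\<in>{0..1}. C x analytic_on {z. Im z > 0}) \<and>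
        (\<forall>x\<in>{0..1}. \<forall>z. Im z > 0 \<longrightarrow> Im (C x z) < 0) \<and>
        (\<forall>x\<in>{0..1}. \<forall>z. Im z > 0 \<longrightarrow>
           C x z = 1 / (z - complex_of_real (f x) - complex_of_real \<epsilon> *
             (LINT y|lebesgue_on {0..1}. complex_of_real ((\<sigma> x y)\<^sup>2) * C y z))) \<and>
        (\<forall>z. Im z > 0 \<longrightarrow>
           (LINT t|\<nu>. cauchy_kernel z t) = (LINT x|lebesgue_on {0..1}. C x z)))"

definition hilbert_transform :: "(real \<Rightarrow> real) \<Rightarrow> real \<Rightarrow> real" where
  "hilbert_transform u s =
     Lim (at_right 0) (\<lambda>\<eta>. set_lebesgue_integral lebesgue {t. \<bar>s - t\<bar> > \<eta>} (\<lambda>t. u t / (s - t)))"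

definition first_order_term :: "(real \<Rightarrow> real) \<Rightarrow> (real \<Rightarrow> real \<Rightarrow> real) \<Rightarrow> real \<Rightarrow> real" where
  "first_order_term \<rho> \<tau> s = - \<rho> s * hilbert_transform (\<lambda>t. \<tau> s t * \<rho> t) s"

definition has_bounded_variation :: "(real \<Rightarrow> real) \<Rightarrow> bool" where
  "has_bounded_variation G \<longleftrightarrow>
     (\<exists>B. \<forall>(x :: nat \<Rightarrow> real) m. mono x \<longrightarrow> (\<Sum>i<m. \<bar>G (x (Suc i)) - G (x i)\<bar>) \<le> B)"

definition positive_variation :: "(real \<Rightarrow> real) \<Rightarrow> real \<Rightarrow> real" where
  "positive_variation G s =
     Sup {\<Sum>i<m. max 0 (G (x (Suc i)) - G (x i)) | (x :: nat \<Rightarrow> real) m. mono x \<and> x m \<le> s}"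

text \<open>The library's Stieltjes measure \<^const>\<open>interval_measure\<close> expects a right-continuous function.\<close>

definition positive_stieltjes_measure :: "(real \<Rightarrow> real) \<Rightarrow> real measure" where
  "positive_stieltjes_measure G =
     interval_measure (\<lambda>s. Lim (at_right s) (positive_variation G))"

text \<open>The integral against the signed measure \<open>dG\<close>, through its Jordan decomposition; the
  negative variation of \<open>G\<close> is the positive variation of \<open>-G\<close>.\<close>

definition stieltjes_integral :: "(real \<Rightarrow> real) \<Rightarrow> (real \<Rightarrow> complex) \<Rightarrow> complex" where
  "stieltjes_integral G g =
     (LINT s|positive_stieltjes_measure G. g s)
       - (LINT s|positive_stieltjes_measure (\<lambda>t. - G t). g s)"

end

theory Submission
  imports Defs "HOL-Real_Asymp.Real_Asymp"
begin

text \<open>For \<open>Im z > 0\<close> the equation for \<open>C\<^sub>\<epsilon>(x,z)\<close> forces \<open>|C\<^sub>\<epsilon>| \<le> 1 / Im z\<close>; inserting it once into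
  itself gives \<open>\<integral>C\<^sub>\<epsilon> = \<integral>g(f x) dx + \<epsilon> \<integral>\<integral>\<sigma>\<^sup>2(x,y) g(f x)\<^sup>2 g(f y) dx dy + O(\<epsilon>\<^sup>2)\<close> with
  \<open>g(t) = 1/(z - t)\<close>, \<open>g' = g\<^sup>2\<close>. On the other hand, truncate the Hilbert transform at distance \<open>\<eta>\<close>: since
  \<open>\<sigma>\<^sup>2\<close> is symmetric and \<open>1/(s - t)\<close> antisymmetric, \<open>g(s)\<^sup>2/(s - t)\<close> may be replaced by half of
  \<open>(g(s)\<^sup>2 - g(t)\<^sup>2)/(s - t) = g(s) g(t) (g(s) + g(t))\<close>, and symmetry turns this back into
  \<open>g(s)\<^sup>2 g(t)\<close>. The Hoelder condition bounds the truncated transforms uniformly, so \<open>\<eta> \<rightarrow> 0\<close> is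
  dominated convergence, and the coefficient of \<open>\<epsilon>\<close> is \<open>-\<integral>g' F\<close>.

  As \<open>\<tau>\<close> itself is not assumed measurable, all double integrals are taken over \<open>[0,1]\<^sup>2\<close>; by
  Lusin's theorem, measurability of \<open>h \<circ> f\<close> implies that of \<open>\<rho> h\<close>, which allows passing to
  the line. The case of bounded variation is integration by parts.\<close>

section \<open>Transfer along the push-forward\<close>

text \<open>Countably many preimages \<open>A n\<close> of basic open sets suffice. Each lies
  between a closed set \<open>F n\<close> and an open set \<open>G n\<close> of small difference;
  off the union \<open>R\<close> of these differences \<open>A n\<close> agrees with
  \<open>G n\<close>, so \<open>f\<close> is continuous there, and a compact subset of
  \<open>E - R\<close> is chosen at the end.\<close>

lemma lusin_compact:
  fixes f :: "'a::euclidean_space \<Rightarrow> 'b::second_countable_topology"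
  assumes E: "E \<in> lmeasurable" and f: "f \<in> borel_measurable (lebesgue_on E)" and e: "0 < e"
  obtains K where "compact K" "K \<subseteq> E" "continuous_on K f" "emeasure lebesgue (E - K) < ennreal e"
proof -
  have Es[measurable]: "E \<in> sets lebesgue" using E by auto
  obtain B :: "'b set set" where B: "countable B" "topological_basis B"
    using ex_countable_basis by auto
  have Bne: "B \<noteq> {}"
    using topological_basisE[OF B(2) open_UNIV, of undefined] by auto
  define U where "U = from_nat_into B"
  have Ub: "U n \<in> B" for n
    using Bne unfolding U_def by (rule from_nat_into)
  have Uo: "open (U n)" for n
    using topological_basis_open[OF B(2) Ub] .
  define A where "A n = E \<inter> f -` U n" for n
  have A: "A n \<in> sets lebesgue" for n
  proof -
    have "f -` U n \<inter> space (lebesgue_on E) \<in> sets (lebesgue_on E)"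
      by (rule measurable_sets[OF f]) (simp add: Uo)
    then show ?thesis
      by (simp add: A_def Int_commute sets_restrict_space_iff)
  qed
  \<comment> \<open>These errors add up to \<open>e / 2\<close>; the other half pays for the passage
    from \<open>E - R\<close> to a compact set.\<close>
  define d where "d n = e / 2 * (1/2) ^ Suc n" for n :: nat
  have dpos: "d n > 0" for n using e by (simp add: d_def)
  have "\<exists>F G. closed F \<and> open G \<and> F \<subseteq> A n \<and> A n \<subseteq> G \<and> emeasure lebesgue (G - F) < ennreal (d n)"
    for n
  proof -
    have d2: "d n / 2 > 0" using dpos by simp
    obtain F where F: "closed F" "F \<subseteq> A n" "emeasure lebesgue (A n - F) < ennreal (d n / 2)"
      using sets_lebesgue_inner_closed[OF A d2] by metis
    obtain G where G: "open G" "A n \<subseteq> G" "emeasure lebesgue (G - A n) < ennreal (d n / 2)"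
      using sets_lebesgue_outer_open[OF A d2] by metis
    have m: "G - A n \<in> sets lebesgue" "A n - F \<in> sets lebesgue"
      using F(1) G(1) A by auto
    have "G - F = (G - A n) \<union> (A n - F)" using F G by auto
    then have "emeasure lebesgue (G - F) \<le> emeasure lebesgue (G - A n) + emeasure lebesgue (A n - F)"
      using m emeasure_subadditive by metis
    also have "\<dots> < ennreal (d n / 2) + ennreal (d n / 2)"
      using F G by (simp add: add_strict_mono)
    also have "\<dots> = ennreal (d n)" using d2 by (subst ennreal_plus[symmetric]) auto
    finally show ?thesis using F G by blast
  qed
  then obtain F G where FG: "\<And>n. closed (F n)" "\<And>n. open (G n)" "\<And>n. F n \<subseteq> A n" "\<And>n. A n \<subseteq> G n"
      "\<And>n. emeasure lebesgue (G n - F n) < ennreal (d n)"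
    by metis
  define R where "R = (\<Union>n. G n - F n)"
  have GF: "G n - F n \<in> sets lebesgue" for n
    using FG(1,2)[of n] by auto
  have R: "R \<in> sets lebesgue" unfolding R_def using GF by auto
  have "(\<lambda>n. e / 2 * (1/2) ^ Suc n) sums (e / 2 * 1)"
    by (intro sums_mult power_half_series)
  then have ds: "d sums (e / 2)" by (simp add: d_def[abs_def])
  have "emeasure lebesgue R \<le> (\<Sum>n. emeasure lebesgue (G n - F n))"
    unfolding R_def using GF by (intro emeasure_subadditive_countably) auto
  also have "\<dots> \<le> (\<Sum>n. ennreal (d n))"
    using FG(5) by (intro suminf_le) (auto intro: less_imp_le)
  also have "\<dots> = ennreal (\<Sum>n. d n)"
    using ds dpos by (intro suminf_ennreal2) (auto simp: sums_iff less_imp_le)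
  also have "(\<Sum>n. d n) = e / 2" using ds by (rule sums_unique[symmetric])
  finally have Rle: "emeasure lebesgue R \<le> ennreal (e / 2)" .
  have ER: "E - R \<in> sets lebesgue" using R by auto
  have e2: "e / 2 > 0" using e by simp
  have fin: "E - R \<in> lmeasurable"
    using ER by (intro fmeasurableI2[OF E]) auto
  obtain K where K: "compact K" "K \<subseteq> E - R" "emeasure lebesgue ((E - R) - K) < ennreal (e / 2)"
  proof -
    have e4: "e / 4 > 0" using e by simp
    obtain T where T: "closed T" "T \<subseteq> E - R" "emeasure lebesgue ((E - R) - T) < ennreal (e / 4)"
      using sets_lebesgue_inner_closed[OF ER e4] by metis
    have Tm: "T \<in> lmeasurable"
      using T fin by (intro fmeasurableI2[OF fin]) auto
    \<comment> \<open>The parts of the closed set \<open>T\<close> outside growing balls decrease to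
      the empty set, and \<open>T\<close> has finite measure, so a large ball loses little of
      it.\<close>
    have lim: "(\<lambda>n. emeasure lebesgue (T - cball 0 (real n))) \<longlonglongrightarrow> emeasure lebesgue (\<Inter>n. T - cball 0 (real n))"
    proof (rule Lim_emeasure_decseq)
      show "range (\<lambda>n. T - cball 0 (real n)) \<subseteq> sets lebesgue" using T by auto
      show "decseq (\<lambda>n. T - cball 0 (real n))" by (auto simp: decseq_def)
      show "emeasure lebesgue (T - cball 0 (real i)) \<noteq> \<infinity>" for i
      proof -
        have "emeasure lebesgue (T - cball 0 (real i)) \<le> emeasure lebesgue T"
          using T by (intro emeasure_mono) auto
        then show ?thesis using Tm by (auto simp: fmeasurable_def top_unique)
      qed
    qed
    have "(\<Inter>n. T - cball 0 (real n)) = {}"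
    proof -
      have "\<exists>n. norm x \<le> real n" for x :: 'a by (rule real_arch_simple)
      then show ?thesis by (auto simp: set_eq_iff)
    qed
    then have "(\<lambda>n. emeasure lebesgue (T - cball 0 (real n))) \<longlonglongrightarrow> 0" 
      using lim by (simp only: emeasure_empty)
    then have "\<forall>\<^sub>F n in sequentially. emeasure lebesgue (T - cball 0 (real n)) < ennreal (e / 4)"
      using e4 by (intro order_tendstoD) auto
    then obtain n where n: "emeasure lebesgue (T - cball 0 (real n)) < ennreal (e / 4)"
      by (auto simp: eventually_sequentially)
    define K where "K = T \<inter> cball 0 (real n)"
    have eq: "(E - R) - K = ((E - R) - T) \<union> (T - cball 0 (real n))"
      using T by (auto simp: K_def)
    have "emeasure lebesgue ((E - R) - K) \<le> emeasure lebesgue ((E - R) - T) + emeasure lebesgue (T - cball 0 (real n))"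
      unfolding eq using T ER by (intro emeasure_subadditive) auto
    also have "\<dots> < ennreal (e / 4) + ennreal (e / 4)"
      using T n by (simp add: add_strict_mono)
    also have "\<dots> = ennreal (e / 2)" using e4 by (subst ennreal_plus[symmetric]) auto
    finally have less: "emeasure lebesgue ((E - R) - K) < ennreal (e / 2)" .
    have "compact K" unfolding K_def using T(1) by (intro closed_Int_compact) auto
    moreover have "K \<subseteq> E - R" using T(2) by (auto simp: K_def)
    ultimately show thesis using less by (rule that)
  qed
  have cont: "continuous_on K f"
    unfolding continuous_on_open_invariant
  proof (intro allI impI)
    fix W :: "'b set" assume "open W"
    then obtain B' where B': "B' \<subseteq> B" "\<Union>B' = W"
      using B(2) unfolding topological_basis_def by meson
    define I where "I = {n. U n \<in> B'}"
    have W: "W = (\<Union>n\<in>I. U n)"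
    proof -
      have "U ` I = B'"
        using B'(1) B(1) Bne unfolding I_def U_def
        by (auto simp: image_iff) (metis from_nat_into_surj subsetD)
      then show ?thesis using B' by simp
    qed
    \<comment> \<open>Points of \<open>G n - F n\<close> belong to \<open>R\<close>, so on
      \<open>K\<close> membership in the open set \<open>G n\<close> decides whether
      \<open>f x\<close> lies in \<open>U n\<close>.\<close>
    have "(\<Union>n\<in>I. G n) \<inter> K = f -` W \<inter> K"
    proof -
      have "x \<in> G n \<longleftrightarrow> f x \<in> U n" if "x \<in> K" for x n
      proof -
        have "x \<in> E" "x \<notin> R" using that K by auto
        then show ?thesis using FG(3,4)[of n] by (auto simp: R_def A_def)
      qed
      then show ?thesis by (auto simp: W)
    qed
    moreover have "open (\<Union>n\<in>I. G n)" using FG by auto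
    ultimately show "\<exists>A. open A \<and> A \<inter> K = f -` W \<inter> K" by blast
  qed
  have "K \<in> sets lebesgue" using compact_imp_closed[OF K(1)] by auto
  have eq: "E - K = (E - R - K) \<union> (E \<inter> R)" using K by auto
  have "emeasure lebesgue (E - K) \<le> emeasure lebesgue (E - R - K) + emeasure lebesgue (E \<inter> R)"
    unfolding eq using ER R \<open>K \<in> sets lebesgue\<close> by (intro emeasure_subadditive) auto
  also have "\<dots> \<le> emeasure lebesgue (E - R - K) + emeasure lebesgue R"
    using R by (intro add_left_mono emeasure_mono) auto
  also have "\<dots> \<le> ennreal (e / 2) + emeasure lebesgue (E - R - K)"
    using Rle by (simp add: add.commute add_right_mono)
  also have "\<dots> < ennreal (e / 2) + ennreal (e / 2)"
    using K(3) by (simp add: ennreal_add_left_cancel_less)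
  also have "\<dots> = ennreal e" using e2 by (subst ennreal_plus[symmetric]) auto
  finally show thesis using that K cont by blast
qed

text \<open>By Lusin, \<open>f -` A\<close> and its complement are up to null sets countable unions of compact
  sets on which \<open>f\<close> is continuous, and the images of the latter are Borel.\<close>

lemma sets_completion_distr_lebesgue_on:
  fixes f :: "'a::euclidean_space \<Rightarrow> 'b::{second_countable_topology, t2_space}"
  assumes S: "S \<in> lmeasurable" and f: "f \<in> borel_measurable (lebesgue_on S)"
    and A: "f -` A \<inter> S \<in> sets lebesgue"
  shows "A \<in> sets (completion (distr (lebesgue_on S) borel f))"
proof -
  let ?D = "distr (lebesgue_on S) borel f"
  have inner: "\<exists>Q\<in>sets borel. Q \<subseteq> A \<and> emeasure lebesgue (f -` (A - Q) \<inter> S) = 0"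
    if A: "f -` A \<inter> S \<in> sets lebesgue" for A
  proof -
    let ?E = "f -` A \<inter> S"
    have E: "?E \<in> lmeasurable" by (rule fmeasurableI2[OF S _ A]) auto
    have fE: "f \<in> borel_measurable (lebesgue_on ?E)"
      using f by (rule measurable_restrict_mono) auto
    have "\<exists>K. compact K \<and> K \<subseteq> ?E \<and> continuous_on K f \<and> emeasure lebesgue (?E - K) < ennreal (1 / Suc n)" for n
      by (rule lusin_compact[OF E fE, of "1 / Suc n"]) (simp, blast)
    then obtain K where K: "\<And>n. compact (K n)" "\<And>n. K n \<subseteq> ?E" "\<And>n. continuous_on (K n) f"
        "\<And>n. emeasure lebesgue (?E - K n) < ennreal (1 / Suc n)"
      by metis
    define Q where "Q = (\<Union>n. f ` K n)"
    have "compact (f ` K n)" for n using K by (intro compact_continuous_image) auto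
    then have "closed (f ` K n)" for n by (rule compact_imp_closed)
    then have Qb: "Q \<in> sets borel" unfolding Q_def by auto
    have "f -` Q \<inter> space (lebesgue_on S) \<in> sets (lebesgue_on S)"
      by (rule measurable_sets[OF f Qb])
    then have fQ: "f -` Q \<inter> S \<in> sets lebesgue"
      using S by (auto simp: sets_restrict_space_iff)
    have "emeasure lebesgue (f -` (A - Q) \<inter> S) \<le> ennreal (1 / Suc n)" for n
    proof -
      have "f -` (A - Q) \<inter> S \<subseteq> ?E - K n" by (auto simp: Q_def)
      moreover have "?E - K n \<in> sets lebesgue" 
        using A compact_imp_closed[OF K(1)[of n]] by (intro sets.Diff) auto
      ultimately have "emeasure lebesgue (f -` (A - Q) \<inter> S) \<le> emeasure lebesgue (?E - K n)"
        by (intro emeasure_mono) auto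
      then show ?thesis using K(4)[of n] by simp
    qed
    moreover have "(\<lambda>n. ennreal (1 / Suc n)) \<longlonglongrightarrow> ennreal 0"
      by (intro tendsto_ennrealI) (rule LIMSEQ_Suc[OF lim_1_over_n])
    ultimately have "emeasure lebesgue (f -` (A - Q) \<inter> S) \<le> ennreal 0"
      by (intro LIMSEQ_le_const) auto
    then show ?thesis using Qb K by (intro bexI[of _ Q]) (auto simp: Q_def)
  qed
  obtain Q where Q: "Q \<in> sets borel" "Q \<subseteq> A" "emeasure lebesgue (f -` (A - Q) \<inter> S) = 0"
    using inner[OF A] by auto
  have "f -` (- A) \<inter> S = S - f -` A \<inter> S" by auto
  then have "f -` (- A) \<inter> S \<in> sets lebesgue" using A S by auto
  then obtain R where R: "R \<in> sets borel" "R \<subseteq> - A" "emeasure lebesgue (f -` (- A - R) \<inter> S) = 0"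
    using inner[of "- A"] by auto
  have m: "f -` X \<inter> S \<in> sets lebesgue" if "X \<in> sets borel" for X
    using measurable_sets[OF f that] S by (auto simp: sets_restrict_space_iff)
  \<comment> \<open>What is missed by both inner approximations, \<open>Q\<close> of
    \<open>A\<close> and \<open>R\<close> of its complement, is Borel and null for the image
    measure. It contains \<open>A - Q\<close>, so \<open>A\<close> is a Borel set up to part of a
    null set.\<close>
  let ?N = "- (Q \<union> R)"
  have N: "?N \<in> sets borel" using Q R by auto
  have 1: "f -` (A - Q) \<inter> S = f -` A \<inter> S - f -` Q \<inter> S"
    "f -` (- A - R) \<inter> S = f -` (- A) \<inter> S - f -` R \<inter> S" by auto
  have "f -` ?N \<inter> S = (f -` (A - Q) \<inter> S) \<union> (f -` (- A - R) \<inter> S)"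
    using Q R by auto
  then have "emeasure lebesgue (f -` ?N \<inter> S) \<le>
      emeasure lebesgue (f -` (A - Q) \<inter> S) + emeasure lebesgue (f -` (- A - R) \<inter> S)"
    using m[OF Q(1)] m[OF R(1)] A \<open>f -` (- A) \<inter> S \<in> sets lebesgue\<close>
    by (metis 1 emeasure_subadditive sets.Diff)
  then have "emeasure lebesgue (f -` ?N \<inter> S) = 0" using Q R by simp
  then have "emeasure ?D ?N = 0"
    using N S f by (simp add: emeasure_distr emeasure_restrict_space)
  then have "?N \<in> null_sets ?D" using N by auto
  moreover have "A = Q \<union> (A - Q)" "A - Q \<subseteq> ?N" using Q R by auto
  ultimately show ?thesis using Q by (intro sets_completionI[of A Q "A - Q" "?N"]) auto
qed

section \<open>Completeness, null sets and a criterion for small o\<close>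

text \<open>Preimages under the two functions differ by part of a null set, which completeness makes
  measurable. It serves for functions that are only known almost everywhere, such as limits of
  truncated transforms.\<close>

lemma (in complete_measure) borel_measurable_cong_AE:
  fixes g h :: "'a \<Rightarrow> 'b::topological_space"
  assumes g: "g \<in> borel_measurable M" and ae: "AE x in M. g x = h x"
  shows "h \<in> borel_measurable M"
proof (rule measurableI)
  fix A :: "'b set" assume "A \<in> sets borel"
  then have A: "g -` A \<inter> space M \<in> sets M" using g by (rule measurable_sets[rotated])
  have "AE x in M. x \<in> g -` A \<inter> space M \<longleftrightarrow> x \<in> h -` A \<inter> space M"
    using ae by eventually_elim auto
  then show "h -` A \<inter> space M \<in> sets M"
    using A Int_lower2 by (rule in_sets_AE)
qed auto

lemma complete_measure_lebesgue: "complete_measure (lebesgue :: 'a::euclidean_space measure)"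
  by (rule completion.complete_measure_axioms)

text \<open>Measurability of \<open>S\<close> turns null sets of the restriction into null sets of
  the completion. The case of interest is Lebesgue measure on the unit interval.\<close>

lemma complete_measure_restrict_completion:
  assumes "S \<in> sets (completion M)"
  shows "complete_measure (restrict_space (completion M) S)"
proof
  fix A B assume "B \<subseteq> A" and A: "A \<in> null_sets (restrict_space (completion M) S)"
  then have "A \<in> null_sets (completion M)" "A \<subseteq> S"
    using assms by (auto simp: null_sets_restrict_space)
  then have "B \<in> sets (completion M)" "B \<subseteq> S"
    using \<open>B \<subseteq> A\<close> completion.complete by auto
  then show "B \<in> sets (restrict_space (completion M) S)"
    by (auto simp: sets_restrict_space image_iff intro!: bexI[of _ B])
qed

text \<open>The interval of length one ending at \<open>a\<close> has positive measure. This
  produces genuine zeros of a function that vanishes almost everywhere far to the left.\<close>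

lemma AE_lborel_ex_le:
  fixes a :: real
  assumes "AE t in lborel. P t"
  shows "\<exists>t\<le>a. P t"
proof (rule ccontr)
  assume "\<not> (\<exists>t\<le>a. P t)"
  then have "AE t in lborel. t \<notin> {a - 1..a}"
    using assms by (auto elim: eventually_mono)
  then have "{a - 1..a} \<in> null_sets lborel"
    by (subst AE_iff_null_sets) auto
  then show False by (auto simp: null_sets_def)
qed

lemma smallo_of_quadratic_bound:
  fixes h :: "real \<Rightarrow> complex"
  assumes "\<And>\<epsilon>. 0 < \<epsilon> \<Longrightarrow> cmod (h \<epsilon>) \<le> D * \<epsilon>\<^sup>2"
  shows "h \<in> o[at_right 0](\<lambda>\<epsilon>. complex_of_real \<epsilon>)"
proof (rule landau_o.smallI)
  fix c :: real assume c: "c > 0"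
  have D: "0 \<le> D" using order_trans[OF norm_ge_zero assms[of 1]] by simp
  \<comment> \<open>The summand 1 keeps the threshold positive when \<open>D = 0\<close>.\<close>
  have "\<forall>\<^sub>F \<epsilon> in at_right 0. 0 < \<epsilon> \<and> \<epsilon> < c / (D + 1)"
    using c D by (intro eventually_at_rightI[of 0 "c / (D + 1)"]) auto
  then show "\<forall>\<^sub>F \<epsilon> in at_right 0. norm (h \<epsilon>) \<le> c * norm (complex_of_real \<epsilon>)"
  proof eventually_elim
    case (elim \<epsilon>)
    then have "\<epsilon> * (D + 1) < c" using D by (simp add: less_divide_eq)
    then have "D * \<epsilon> \<le> c" using elim D by (simp add: algebra_simps)
    have "cmod (h \<epsilon>) \<le> D * \<epsilon> * \<epsilon>"
      using assms[of \<epsilon>] elim by (simp add: power2_eq_square mult.assoc)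
    also have "\<dots> \<le> c * \<epsilon>"
      using \<open>D * \<epsilon> \<le> c\<close> elim by (intro mult_right_mono) auto
    finally show ?case using elim by simp
  qed
qed

section \<open>Measurability and integrals with respect to the density of \<open>f\<close>\<close>

locale pushforward_density =
  fixes f \<rho> :: "real \<Rightarrow> real"
  assumes \<rho>_nonneg: "\<And>t. 0 \<le> \<rho> t"
    and density: "distributed (lebesgue_on {0..1}) lborel f (\<lambda>t. ennreal (\<rho> t))"
begin

abbreviation "\<kappa> \<equiv> lebesgue_on {0..1::real}"

lemma f_measurable[measurable]: "f \<in> borel_measurable \<kappa>"
  using distributed_measurable[OF density] by simp

lemma \<rho>_measurable[measurable]: "\<rho> \<in> borel_measurable borel"
  using distributed_real_measurable[OF _ density] \<rho>_nonneg by simp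

lemma distr_eq: "distr \<kappa> borel f = density lborel (\<lambda>t. ennreal (\<rho> t))"
  using distributed_distr_eq_density[OF density] by (simp cong: distr_cong)

text \<open>The law of \<open>f\<close> is absolutely continuous, so it does not charge Lebesgue
  null sets.\<close>

lemma AE_pullback:
  assumes "AE t in lborel. P t"
  shows "AE x in \<kappa>. P (f x)"
proof -
  have "AE t in density lborel (\<lambda>t. ennreal (\<rho> t)). P t"
    using assms by (subst AE_density) auto
  then have "AE t in distr \<kappa> borel f. P t" unfolding distr_eq .
  then show ?thesis by (rule AE_distrD[rotated]) simp
qed

text \<open>By the consequence of Lusin's theorem, \<open>h\<close> is measurable for the completed
  law of \<open>f\<close>, hence equal to a Borel function outside a null set of that law. On such a
  set \<open>\<rho>\<close> vanishes almost everywhere, so the factor \<open>\<rho>\<close> hides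
  the values of \<open>h\<close> that \<open>f\<close> does not see.\<close>

lemma borel_version:
  fixes h :: "real \<Rightarrow> real"
  assumes h: "(\<lambda>x. h (f x)) \<in> borel_measurable \<kappa>"
  obtains h' where "h' \<in> borel_measurable borel" "AE x in \<kappa>. h (f x) = h' (f x)"
    "AE t in lborel. \<rho> t * h t = \<rho> t * h' t"
proof -
  let ?D = "distr \<kappa> borel f"
  have "h \<in> borel_measurable (completion ?D)"
  proof (rule measurableI)
    fix A :: "real set" assume A: "A \<in> sets borel"
    have "(\<lambda>x. h (f x)) -` A \<inter> {0..1} \<in> sets lebesgue"
      using measurable_sets[OF h A] by (auto simp: sets_restrict_space_iff)
    then have "f -` (h -` A) \<inter> {0..1} \<in> sets lebesgue" by (simp add: vimage_def)
    then have "h -` A \<in> sets (completion ?D)"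
      using f_measurable by (intro sets_completion_distr_lebesgue_on) auto
    then show "h -` A \<inter> space (completion ?D) \<in> sets (completion ?D)"
      by (simp only: space_completion space_distr space_borel Int_UNIV_right)
  qed simp
  from completion_ex_borel_measurable_real[OF this]
  obtain h' where h': "h' \<in> borel_measurable ?D" "AE t in ?D. h t = h' t" by auto
  have "AE x in \<kappa>. h (f x) = h' (f x)"
    using h'(2) by (rule AE_distrD[rotated]) simp
  moreover have "AE t in lborel. \<rho> t * h t = \<rho> t * h' t"
  proof -
    have "AE t in lborel. 0 < ennreal (\<rho> t) \<longrightarrow> h t = h' t"
      using h'(2) unfolding distr_eq by (subst (asm) AE_density) auto
    then show ?thesis
    proof eventually_elim
      case (elim t)
      then show ?case using \<rho>_nonneg[of t] by (cases "\<rho> t = 0") (auto simp: ennreal_less_zero_iff)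
    qed
  qed
  ultimately show thesis using that h'(1) by simp
qed

lemma pullback_measurable:
  fixes h :: "real \<Rightarrow> real"
  assumes h: "(\<lambda>x. h (f x)) \<in> borel_measurable \<kappa>"
  shows "(\<lambda>t. \<rho> t * h t) \<in> borel_measurable lebesgue"
proof -
  obtain h' where h': "h' \<in> borel_measurable borel" "AE t in lborel. \<rho> t * h t = \<rho> t * h' t"
    using borel_version[OF h] by auto
  have "(\<lambda>t. \<rho> t * h' t) \<in> borel_measurable lebesgue"
    using h'(1) by (intro measurable_completion) simp
  moreover have "AE t in lebesgue. \<rho> t * h' t = \<rho> t * h t"
    using h'(2) by (intro AE_completion) auto
  ultimately show ?thesis
    by (rule complete_measure.borel_measurable_cong_AE[OF complete_measure_lebesgue])
qed

text \<open>This is the change of variables for a Borel version of \<open>h\<close>, carried over by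
  equality almost everywhere. Splitting off the Borel factor \<open>k\<close> confines the
  measurability problem to a real function while the integrand may be complex.\<close>

lemma pullback_integral:
  fixes h :: "real \<Rightarrow> real" and k :: "real \<Rightarrow> 'b::{banach, second_countable_topology}"
  assumes h: "(\<lambda>x. h (f x)) \<in> borel_measurable \<kappa>" and k: "k \<in> borel_measurable borel"
  shows "(LINT t|lebesgue. (\<rho> t * h t) *\<^sub>R k t) = (LINT x|\<kappa>. h (f x) *\<^sub>R k (f x))" (is ?int)
    and "integrable lebesgue (\<lambda>t. (\<rho> t * h t) *\<^sub>R k t) \<longleftrightarrow> integrable \<kappa> (\<lambda>x. h (f x) *\<^sub>R k (f x))" (is ?ible)
proof -
  note [measurable] = k
  obtain h' where h'[measurable]: "h' \<in> borel_measurable borel"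
    and ae: "AE x in \<kappa>. h (f x) = h' (f x)" "AE t in lborel. \<rho> t * h t = \<rho> t * h' t"
    using borel_version[OF h] by auto
  have ae': "AE t in lebesgue. \<rho> t * h t = \<rho> t * h' t" using ae(2) by (rule AE_completion)
  note m = pullback_measurable[OF h]
  have k': "k \<in> borel_measurable lebesgue" using k by (intro measurable_completion) simp
  have h'': "(\<lambda>t. \<rho> t * h' t) \<in> borel_measurable lebesgue"
    by (intro measurable_completion) simp
  note [measurable] = k' m h'' h
  have lhs: "(LINT t|lebesgue. (\<rho> t * h t) *\<^sub>R k t) = (LINT t|lebesgue. (\<rho> t * h' t) *\<^sub>R k t)"
    using ae' by (intro integral_cong_AE) auto
  also have "\<dots> = (LINT t|lborel. (\<rho> t * h' t) *\<^sub>R k t)"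
    by (intro integral_completion) simp
  also have "\<dots> = (LINT t|lborel. \<rho> t *\<^sub>R (h' t *\<^sub>R k t))" by simp
  also have "\<dots> = (LINT t|distr \<kappa> borel f. h' t *\<^sub>R k t)"
    unfolding distr_eq using \<rho>_nonneg by (intro integral_density[symmetric]) auto
  also have "\<dots> = (LINT x|\<kappa>. h' (f x) *\<^sub>R k (f x))"
    by (intro integral_distr) auto
  also have "\<dots> = (LINT x|\<kappa>. h (f x) *\<^sub>R k (f x))"
    using ae(1) by (intro integral_cong_AE) auto
  finally show ?int .
  have "integrable lebesgue (\<lambda>t. (\<rho> t * h t) *\<^sub>R k t) \<longleftrightarrow> integrable lebesgue (\<lambda>t. (\<rho> t * h' t) *\<^sub>R k t)"
    using ae' by (intro integrable_cong_AE) auto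
  also have "\<dots> \<longleftrightarrow> integrable lborel (\<lambda>t. \<rho> t *\<^sub>R (h' t *\<^sub>R k t))"
    by (subst integrable_completion) auto
  also have "\<dots> \<longleftrightarrow> integrable (distr \<kappa> borel f) (\<lambda>t. h' t *\<^sub>R k t)"
    unfolding distr_eq using \<rho>_nonneg by (intro integrable_density[symmetric]) auto
  also have "\<dots> \<longleftrightarrow> integrable \<kappa> (\<lambda>x. h' (f x) *\<^sub>R k (f x))"
    by (intro integrable_distr_eq) auto
  also have "\<dots> \<longleftrightarrow> integrable \<kappa> (\<lambda>x. h (f x) *\<^sub>R k (f x))"
    using ae(1) by (intro integrable_cong_AE) auto
  finally show ?ible .
qed

end

text \<open>The law of \<open>f\<close> gives \<open>A\<close> no mass. The set in question will be
  the half-line below the range of \<open>f\<close>.\<close>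

lemma (in pushforward_density) AE_\<rho>_eq_0:
  assumes A: "A \<in> sets borel" "\<And>x. x \<in> {0..1} \<Longrightarrow> f x \<notin> A"
  shows "AE t in lborel. t \<in> A \<longrightarrow> \<rho> t = 0"
proof -
  have "f -` A \<inter> space \<kappa> = {}" using A(2) by auto
  then have "A \<in> null_sets (distr \<kappa> borel f)"
    using A(1) by (intro null_setsI) (simp_all add: emeasure_distr)
  then have "A \<in> null_sets (density lborel (\<lambda>t. ennreal (\<rho> t)))"
    unfolding distr_eq .
  then have "AE t\<in>A in lborel. ennreal (\<rho> t) = 0"
    by (subst (asm) null_sets_density_iff) auto
  then show ?thesis
  proof eventually_elim
    case (elim t)
    then show ?case using \<rho>_nonneg[of t] by auto
  qed
qed

section \<open>Principal values\<close>

text \<open>A power integrable at 0 is added to its reflection; the two halves overlap only at 0,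
  where \<open>powr\<close> is 0. With exponent \<open>\<alpha> - 1\<close> this is the majorant of
  a Hoelder quotient.\<close>

lemma integrable_abs_powr:
  fixes a r :: real
  assumes "a > -1" "r \<ge> 0"
  shows "integrable lborel (\<lambda>t. indicator {-r..r} t * \<bar>t\<bar> powr a)"
proof -
  have "(\<lambda>x. x powr a) absolutely_integrable_on {0..r}"
    using integrable_on_powr_from_0[OF assms] by (intro nonnegative_absolutely_integrable_1) auto
  then have "integrable lebesgue (\<lambda>t. indicator {0..r} t * t powr a)"
    by (simp add: set_integrable_def)
  then have 1: "integrable lborel (\<lambda>t. indicator {0..r} t * t powr a)"
    by (subst (asm) integrable_completion) auto
  have 2: "integrable lborel (\<lambda>t. indicator {0..r} (0 + -1 * t) * (0 + -1 * t) powr a)"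
    by (intro lborel_integrable_real_affine 1) simp
  have "integrable lborel (\<lambda>t. indicator {0..r} t * t powr a +
      indicator {0..r} (0 + -1 * t) * (0 + -1 * t) powr a)"
    by (intro Bochner_Integration.integrable_add 1 2)
  then show ?thesis
    by (rule Bochner_Integration.integrable_cong[OF refl, THEN iffD1, rotated])
       (auto simp: indicator_def)
qed

text \<open>The reflection of \<open>t\<close> to \<open>2 * s - t\<close> preserves the annulus and
  changes the sign of \<open>1 / (s - t)\<close>.\<close>

lemma integral_annulus_inverse_eq_0:
  fixes s \<eta> r :: real
  shows "(LINT t|lborel. indicator {t. \<eta> < \<bar>s - t\<bar> \<and> \<bar>s - t\<bar> \<le> r} t / (s - t)) = 0" (is "integral\<^sup>L _ ?m = 0")
proof -
  have "integral\<^sup>L lborel ?m = \<bar>-1\<bar> *\<^sub>R (LINT t|lborel. ?m (2 * s + -1 * t))"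
    by (rule lborel_integral_real_affine) simp
  also have "(\<lambda>t. ?m (2 * s + -1 * t)) = (\<lambda>t. - ?m t)"
  proof
    fix t
    have "s - (2 * s + -1 * t) = - (s - t)" by simp
    then show "?m (2 * s + -1 * t) = - ?m t"
      by (simp only: indicator_def mem_Collect_eq abs_minus_cancel minus_divide_right)
  qed
  finally show ?thesis by simp
qed

text \<open>Within distance \<open>r\<close> of \<open>s\<close> the constant
  \<open>\<phi> s\<close> may be subtracted, as its contribution vanishes by oddness. The remaining
  quotient is dominated by \<open>C * \<bar>t - s\<bar> powr (\<alpha> - 1)\<close>, which is
  integrable, and beyond distance \<open>r\<close> the kernel is at most \<open>1 / r\<close>. The
  bound is therefore uniform in the truncation.\<close>

lemma principal_value_Hoelder:
  fixes \<phi> :: "real \<Rightarrow> real" and s r \<alpha> C :: real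
  assumes \<phi>: "integrable lebesgue \<phi>" and r: "0 < r" and \<alpha>: "0 < \<alpha>"
    and hoelder: "\<And>t. t \<in> {s - r..s + r} \<Longrightarrow> \<bar>\<phi> t - \<phi> s\<bar> \<le> C * \<bar>t - s\<bar> powr \<alpha>"
  defines "J \<equiv> \<lambda>\<eta>. set_lebesgue_integral lebesgue {t. \<bar>s - t\<bar> > \<eta>} (\<lambda>t. \<phi> t / (s - t))"
  shows "\<exists>l. (J \<longlongrightarrow> l) (at_right 0)"
    and "\<And>\<eta>. 0 < \<eta> \<Longrightarrow> \<eta> < r \<Longrightarrow>
       \<bar>J \<eta>\<bar> \<le> C * (LINT t|lborel. indicator {-r..r} t * \<bar>t\<bar> powr (\<alpha> - 1)) + (LINT t|lebesgue. \<bar>\<phi> t\<bar>) / r"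
proof -
  have m\<phi>[measurable]: "\<phi> \<in> borel_measurable lebesgue" using \<phi> by auto
  have mb: "g \<in> borel_measurable lebesgue" if "g \<in> borel_measurable borel" for g :: "real \<Rightarrow> real"
    using that by (intro measurable_completion) simp
  \<comment> \<open>The integrand splits into the Hoelder quotient \<open>\<psi>\<close>, the odd
    annulus kernel \<open>m\<close> and the far part \<open>q\<close>, with \<open>D\<close> as
    majorant of \<open>\<psi>\<close>.\<close>
  define \<psi> where "\<psi> \<eta> t = indicator {t. \<eta> < \<bar>s - t\<bar> \<and> \<bar>s - t\<bar> \<le> r} t * ((\<phi> t - \<phi> s) / (s - t))" for \<eta> t
  define m where "m \<eta> t = indicator {t. \<eta> < \<bar>s - t\<bar> \<and> \<bar>s - t\<bar> \<le> r} t / (s - t)" for \<eta> t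
  define q where "q t = indicator {t. \<bar>s - t\<bar> > r} t * (\<phi> t / (s - t))" for t
  define D where "D t = C * (indicator {-r..r} (t - s) * \<bar>t - s\<bar> powr (\<alpha> - 1))" for t
  have Dint0: "integrable lborel (\<lambda>t. indicator {-r..r} t * \<bar>t\<bar> powr (\<alpha> - 1))"
    using \<alpha> r by (intro integrable_abs_powr) auto
  have "integrable lborel (\<lambda>t. indicator {-r..r} (- s + 1 * t) * \<bar>- s + 1 * t\<bar> powr (\<alpha> - 1))"
    by (intro lborel_integrable_real_affine[OF Dint0]) simp
  then have Dlb: "integrable lborel D"
    unfolding D_def by simp
  then have D: "integrable lebesgue D"
    by (intro integrable_completion[THEN iffD2]) auto
  have intD: "(LINT t|lebesgue. D t) = C * (LINT t|lborel. indicator {-r..r} t * \<bar>t\<bar> powr (\<alpha> - 1))"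
  proof -
    have "(LINT t|lebesgue. D t) = (LINT t|lborel. D t)"
      using Dlb by (intro integral_completion) auto
    also have "\<dots> = C * (LINT t|lborel. indicator {-r..r} (- s + 1 * t) * \<bar>- s + 1 * t\<bar> powr (\<alpha> - 1))"
      unfolding D_def by simp
    also have "(LINT t|lborel. indicator {-r..r} t * \<bar>t\<bar> powr (\<alpha> - 1)) =
       \<bar>1\<bar> *\<^sub>R (LINT t|lborel. indicator {-r..r} (- s + 1 * t) * \<bar>- s + 1 * t\<bar> powr (\<alpha> - 1))"
      by (rule lborel_integral_real_affine) simp
    ultimately show ?thesis by simp
  qed
  have \<psi>D: "\<bar>\<psi> \<eta> t\<bar> \<le> D t" if "0 \<le> \<eta>" for \<eta> t
  proof (cases "\<eta> < \<bar>s - t\<bar> \<and> \<bar>s - t\<bar> \<le> r")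
    case True
    then have pos: "\<bar>t - s\<bar> > 0" and t: "t \<in> {s - r..s + r}" "t - s \<in> {-r..r}"
      using that by auto
    have "\<bar>\<psi> \<eta> t\<bar> = \<bar>\<phi> t - \<phi> s\<bar> / \<bar>t - s\<bar>"
      using True by (simp add: \<psi>_def abs_minus_commute)
    also have "\<dots> \<le> (C * \<bar>t - s\<bar> powr \<alpha>) / \<bar>t - s\<bar>"
      using hoelder[OF t(1)] by (intro divide_right_mono) auto
    also have "\<dots> = C * \<bar>t - s\<bar> powr (\<alpha> - 1)"
      using pos by (simp add: powr_diff)
    finally show ?thesis using t by (simp add: D_def)
  next
    case False
    \<comment> \<open>The sign of \<open>C\<close> comes from the Hoelder bound at \<open>t\<close>,
      except at \<open>t = s\<close>, where \<open>0 powr (\<alpha> - 1) = 0\<close>.\<close>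
    have "0 \<le> D t"
    proof (cases "t - s \<in> {-r..r}")
      case True
      have "0 \<le> C * \<bar>t - s\<bar> powr \<alpha>" using hoelder[of t] True by (auto intro: order_trans[OF abs_ge_zero])
      then have "0 \<le> C \<or> t = s" by (auto simp: zero_le_mult_iff)
      then show ?thesis by (auto simp: D_def)
    qed (simp add: D_def)
    then show ?thesis using False by (simp add: \<psi>_def)
  qed
  have m\<psi>[measurable]: "\<psi> \<eta> \<in> borel_measurable lebesgue" for \<eta>
  proof -
    have [measurable]: "(\<lambda>t. indicator {t. \<eta> < \<bar>s - t\<bar> \<and> \<bar>s - t\<bar> \<le> r} t :: real) \<in> borel_measurable lebesgue"
      "(\<lambda>t. s - t) \<in> borel_measurable lebesgue"
      by (auto intro!: mb)
    show ?thesis unfolding \<psi>_def by measurable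
  qed
  have \<psi>: "integrable lebesgue (\<psi> \<eta>)" if "0 \<le> \<eta>" for \<eta>
    using \<psi>D[OF that]
    by (intro Bochner_Integration.integrable_bound[OF D]) (auto intro!: order_trans[OF _ abs_ge_self])
  have m: "integrable lebesgue (m \<eta>)" if "0 < \<eta>" for \<eta>
  proof (rule Bochner_Integration.integrable_bound)
    show "integrable lebesgue (\<lambda>t. indicator {s - r..s + r} t / \<eta>)"
      by (intro integrable_divide_zero impI) (auto simp: integrable_indicator_iff emeasure_lborel_Icc_eq)
    show "m \<eta> \<in> borel_measurable lebesgue"
      unfolding m_def by (intro mb) simp
    show "AE t in lebesgue. norm (m \<eta> t) \<le> norm (indicator {s - r..s + r} t / \<eta>)"
    proof (rule AE_I2)
      fix t
      show "norm (m \<eta> t) \<le> norm (indicator {s - r..s + r} t / \<eta>)"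
      proof (cases "\<eta> < \<bar>s - t\<bar> \<and> \<bar>s - t\<bar> \<le> r")
        case True
        then have "1 / \<bar>s - t\<bar> \<le> 1 / \<eta>" using that by (intro divide_left_mono) auto
        then show ?thesis using True that by (auto simp: m_def indicator_def)
      qed (simp add: m_def)
    qed
  qed
  have intm: "(LINT t|lebesgue. m \<eta> t) = 0" for \<eta>
    unfolding m_def by (subst integral_completion) (auto simp: integral_annulus_inverse_eq_0)
  have mq[measurable]: "q \<in> borel_measurable lebesgue"
  proof -
    have [measurable]: "(\<lambda>t. indicator {t. \<bar>s - t\<bar> > r} t :: real) \<in> borel_measurable lebesgue"
      "(\<lambda>t. s - t) \<in> borel_measurable lebesgue"
      by (auto intro!: mb)
    show ?thesis unfolding q_def by measurable
  qed
  have qb: "\<bar>q t\<bar> \<le> \<bar>\<phi> t\<bar> / r" for t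
  proof (cases "\<bar>s - t\<bar> > r")
    case True
    then have "\<bar>\<phi> t\<bar> / \<bar>s - t\<bar> \<le> \<bar>\<phi> t\<bar> / r" using r by (intro divide_left_mono) auto
    then show ?thesis using True by (simp add: q_def)
  qed (use r in \<open>simp add: q_def\<close>)
  have abs\<phi>: "integrable lebesgue (\<lambda>t. \<bar>\<phi> t\<bar> / r)"
    using \<phi> by (intro integrable_divide_zero impI integrable_abs)
  have q: "integrable lebesgue q"
    by (rule Bochner_Integration.integrable_bound[OF abs\<phi>]) (use qb r in \<open>auto intro!: order_trans[OF qb]\<close>)
  have J: "J \<eta> = (LINT t|lebesgue. \<psi> \<eta> t) + (LINT t|lebesgue. q t)" if \<eta>: "0 < \<eta>" "\<eta> < r" for \<eta>
  proof -
    have "J \<eta> = (LINT t|lebesgue. \<psi> \<eta> t + \<phi> s * m \<eta> t + q t)"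
      unfolding J_def set_lebesgue_integral_def
    proof (intro Bochner_Integration.integral_cong refl)
      fix t
      show "indicator {t. \<bar>s - t\<bar> > \<eta>} t *\<^sub>R (\<phi> t / (s - t)) = \<psi> \<eta> t + \<phi> s * m \<eta> t + q t"
        using \<eta> by (auto simp: \<psi>_def m_def q_def indicator_def diff_divide_distrib)
    qed
    also have "\<dots> = (LINT t|lebesgue. \<psi> \<eta> t) + \<phi> s * (LINT t|lebesgue. m \<eta> t) + (LINT t|lebesgue. q t)"
      using \<psi>[of \<eta>] m[of \<eta>] q \<eta> by simp
    finally show ?thesis by (simp add: intm)
  qed
  show "\<exists>l. (J \<longlongrightarrow> l) (at_right 0)"
  proof (intro exI tendsto_at_right_sequentially)
    show "0 < r" by fact
    fix S :: "nat \<Rightarrow> real"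
    assume S: "\<And>n. 0 < S n" "\<And>n. S n < r" "decseq S" "S \<longlonglongrightarrow> 0"
    \<comment> \<open>At each point \<open>\<psi> (S n)\<close> is eventually equal to
      \<open>\<psi> 0\<close>, the quotient without truncation, and \<open>D\<close> dominates them
      all.\<close>
    have "(\<lambda>n. (LINT t|lebesgue. \<psi> (S n) t)) \<longlonglongrightarrow> (LINT t|lebesgue. \<psi> 0 t)"
    proof (rule integral_dominated_convergence)
      show "integrable lebesgue D" by (rule D)
      show "AE t in lebesgue. norm (\<psi> (S n) t) \<le> D t" for n
        using \<psi>D[of "S n"] S(1)[of n] by (simp add: less_imp_le)
      show "AE t in lebesgue. (\<lambda>n. \<psi> (S n) t) \<longlonglongrightarrow> \<psi> 0 t"
      proof (rule AE_I2)
        fix t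
        show "(\<lambda>n. \<psi> (S n) t) \<longlonglongrightarrow> \<psi> 0 t"
        proof (cases "t = s")
          case False
          then have "\<forall>\<^sub>F n in sequentially. S n < \<bar>s - t\<bar>"
            using S(4) by (intro order_tendstoD) auto
          then have "\<forall>\<^sub>F n in sequentially. \<psi> (S n) t = \<psi> 0 t"
            by (rule eventually_mono) (use False in \<open>auto simp: \<psi>_def indicator_def\<close>)
          then show ?thesis by (rule tendsto_eventually)
        qed (simp add: \<psi>_def)
      qed
    qed auto
    then show "(\<lambda>n. J (S n)) \<longlonglongrightarrow> (LINT t|lebesgue. \<psi> 0 t) + (LINT t|lebesgue. q t)"
      using S by (simp add: J tendsto_add)
  qed
  fix \<eta> :: real assume \<eta>: "0 < \<eta>" "\<eta> < r"
  have "\<bar>LINT t|lebesgue. \<psi> \<eta> t\<bar> \<le> (LINT t|lebesgue. D t)"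
    using Bochner_Integration.integral_norm_bound_integral[OF \<psi> D, of \<eta>] \<psi>D[of \<eta>] \<eta> by simp
  moreover have "\<bar>LINT t|lebesgue. q t\<bar> \<le> (LINT t|lebesgue. \<bar>\<phi> t\<bar> / r)"
    using Bochner_Integration.integral_norm_bound_integral[OF q abs\<phi>] qb by simp
  ultimately show "\<bar>J \<eta>\<bar> \<le> C * (LINT t|lborel. indicator {-r..r} t * \<bar>t\<bar> powr (\<alpha> - 1)) + (LINT t|lebesgue. \<bar>\<phi> t\<bar>) / r"
    using J[OF \<eta>] intD by simp
qed

section \<open>The Cauchy kernel\<close>

lemma minus_of_real_nonzero: "z - complex_of_real t \<noteq> 0" if "Im z > 0"
proof
  assume "z - complex_of_real t = 0"
  then have "Im (z - complex_of_real t) = 0" by (metis zero_complex.simps(2))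
  then show False using that by simp
qed

lemma cauchy_kernel_measurable[measurable]: "cauchy_kernel z \<in> borel_measurable borel"
  unfolding cauchy_kernel_def[abs_def] by measurable

lemma cauchy_kernel_le:
  assumes "Im z > 0"
  shows "cmod (cauchy_kernel z t) \<le> 1 / Im z"
proof -
  have "Im z \<le> cmod (z - complex_of_real t)"
    using abs_Im_le_cmod[of "z - complex_of_real t"] assms by simp
  then show ?thesis
    using assms by (simp add: cauchy_kernel_def norm_divide frac_le)
qed

text \<open>The relation \<open>g' = g\<^sup>2\<close> matches the derivative of the test function
  with the squared kernel that the expansion produces.\<close>

lemma cauchy_kernel_vector_derivative:
  assumes "Im z > 0"
  shows "(cauchy_kernel z has_vector_derivative (cauchy_kernel z t)\<^sup>2) (at t)"
proof -
  have "((\<lambda>u. 1 / (z - u)) has_field_derivative (1 / (z - of_real t))\<^sup>2) (at (complex_of_real t))"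
    using minus_of_real_nonzero[OF assms] by (auto intro!: derivative_eq_intros simp: power2_eq_square)
  then have "((\<lambda>t. 1 / (z - complex_of_real t)) has_vector_derivative (1 / (z - of_real t))\<^sup>2) (at t)"
    by (rule has_vector_derivative_real_field)
  then show ?thesis unfolding cauchy_kernel_def[abs_def] .
qed

text \<open>The modulus of the square is \<open>1 / ((Re z - t)\<^sup>2 + (Im z)\<^sup>2)\<close>,
  an affine rescaling of \<open>1 / (1 + u\<^sup>2)\<close>.\<close>

lemma cauchy_kernel_square_integrable:
  assumes z: "Im z > 0"
  shows "integrable lborel (\<lambda>t. (cauchy_kernel z t)\<^sup>2)"
proof (rule Bochner_Integration.integrable_bound)
  have "integrable lborel (\<lambda>x::real. inverse (1 + x\<^sup>2))"
    using integrable_inverse_1_plus_square by (simp add: set_integrable_def)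
  then have "integrable lborel (\<lambda>t. inverse (1 + (- (Re z / Im z) + (1 / Im z) * t)\<^sup>2))"
    by (rule lborel_integrable_real_affine) (use z in simp)
  then show "integrable lborel (\<lambda>t. (1 / (Im z)\<^sup>2) * inverse (1 + (- (Re z / Im z) + (1 / Im z) * t)\<^sup>2))"
    by (rule integrable_mult_right)
  show "(\<lambda>t. (cauchy_kernel z t)\<^sup>2) \<in> borel_measurable lborel" by simp
  show "AE t in lborel. norm ((cauchy_kernel z t)\<^sup>2)
      \<le> norm ((1 / (Im z)\<^sup>2) * inverse (1 + (- (Re z / Im z) + (1 / Im z) * t)\<^sup>2))"
  proof (rule AE_I2)
    fix t
    have "norm ((cauchy_kernel z t)\<^sup>2) = 1 / ((Re z - t)\<^sup>2 + (Im z)\<^sup>2)"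
      by (simp add: cauchy_kernel_def norm_power norm_divide power_divide cmod_power2)
    also have "(Re z - t)\<^sup>2 + (Im z)\<^sup>2 = (Im z)\<^sup>2 * (1 + (- (Re z / Im z) + (1 / Im z) * t)\<^sup>2)"
      using z by (simp add: power2_eq_square field_simps)
    also have "1 / \<dots> = (1 / (Im z)\<^sup>2) * inverse (1 + (- (Re z / Im z) + (1 / Im z) * t)\<^sup>2)"
      by (simp add: divide_inverse)
    finally show "norm ((cauchy_kernel z t)\<^sup>2)
      \<le> norm ((1 / (Im z)\<^sup>2) * inverse (1 + (- (Re z / Im z) + (1 / Im z) * t)\<^sup>2))"
      by (metis abs_ge_self real_norm_def)
  qed
qed

lemma cauchy_kernel_tendsto_0:
  "(cauchy_kernel z \<longlongrightarrow> 0) at_top" "(cauchy_kernel z \<longlongrightarrow> 0) at_bot"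
proof -
  have le: "cmod (cauchy_kernel z t) \<le> 1 / \<bar>Re z - t\<bar>" if "t \<noteq> Re z" for t
    using abs_Re_le_cmod[of "z - complex_of_real t"] that
    by (simp add: cauchy_kernel_def norm_divide frac_le)
  have le_top: "cmod (cauchy_kernel z t) \<le> 1 / (t - Re z)" if "Re z < t" for t
    using le[of t] that by simp
  have le_bot: "cmod (cauchy_kernel z t) \<le> 1 / (Re z - t)" if "t < Re z" for t
    using le[of t] that by simp
  show "(cauchy_kernel z \<longlongrightarrow> 0) at_top"
  proof (rule Lim_null_comparison)
    show "\<forall>\<^sub>F t in at_top. cmod (cauchy_kernel z t) \<le> 1 / (t - Re z)"
      using eventually_gt_at_top[of "Re z"] by (rule eventually_mono) (rule le_top)
    show "((\<lambda>t. 1 / (t - Re z)) \<longlongrightarrow> 0) at_top" by real_asymp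
  qed
  show "(cauchy_kernel z \<longlongrightarrow> 0) at_bot"
  proof (rule Lim_null_comparison)
    show "\<forall>\<^sub>F t in at_bot. cmod (cauchy_kernel z t) \<le> 1 / (Re z - t)"
      using eventually_gt_at_bot[of "Re z"] by (rule eventually_mono) (rule le_bot)
    show "((\<lambda>t. 1 / (Re z - t)) \<longlongrightarrow> 0) at_bot" by real_asymp
  qed
qed

section \<open>Second-order expansion of the transform\<close>

locale band_profile = pushforward_density f \<rho> for f \<rho> :: "real \<Rightarrow> real" +
  fixes \<sigma> \<tau> :: "real \<Rightarrow> real \<Rightarrow> real" and K :: real
  assumes \<sigma>_bound: "\<And>x y. x \<in> {0..1} \<Longrightarrow> y \<in> {0..1} \<Longrightarrow> (\<sigma> x y)\<^sup>2 \<le> K"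
    and disc_closed: "closed (discontinuities \<sigma>)"
    and disc_finite: "\<And>x. x \<in> {0..1} \<Longrightarrow> finite {y. (x, y) \<in> discontinuities \<sigma>}"
    and \<tau>_sym: "\<And>s t. \<tau> s t = \<tau> t s"
    and \<tau>: "\<And>x y. x \<in> {0..1} \<Longrightarrow> y \<in> {0..1} \<Longrightarrow> (\<sigma> x y)\<^sup>2 = \<tau> (f x) (f y)"
begin

lemma K_nonneg: "0 \<le> K"
  using \<sigma>_bound[of 0 0] by (auto intro: order_trans[OF zero_le_power2])

sublocale unit: prob_space \<kappa>
  by (rule prob_spaceI) (simp add: emeasure_restrict_space)

sublocale unit2: pair_prob_space \<kappa> \<kappa> ..

text \<open>Off the closed set of discontinuities, \<open>\<sigma>\<^sup>2\<close> is jointly Borel; the slices are changed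
  at finitely many points only.\<close>

definition w :: "real \<times> real \<Rightarrow> real" where
  "w p = (if p \<in> {0..1} \<times> {0..1} - discontinuities \<sigma> then (\<sigma> (fst p) (snd p))\<^sup>2 else 0)"

lemma w_borel: "w \<in> borel_measurable borel"
proof -
  let ?Q = "{0..1::real} \<times> {0..1::real}"
  have "closed ?Q" by (intro closed_Times) auto
  then have "?Q - discontinuities \<sigma> \<in> sets borel" using disc_closed by auto
  moreover have "continuous_on (?Q - discontinuities \<sigma>) (\<lambda>p. (\<sigma> (fst p) (snd p))\<^sup>2)"
  proof (intro continuous_on_power)
    show "continuous_on (?Q - discontinuities \<sigma>) (\<lambda>p. \<sigma> (fst p) (snd p))"
      unfolding continuous_on_eq_continuous_within
    proof
      fix p assume "p \<in> ?Q - discontinuities \<sigma>"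
      then have "continuous (at p within ?Q) (\<lambda>p. \<sigma> (fst p) (snd p))"
        by (auto simp: discontinuities_def case_prod_beta')
      then show "continuous (at p within ?Q - discontinuities \<sigma>) (\<lambda>p. \<sigma> (fst p) (snd p))"
        by (rule continuous_within_subset) auto
    qed
  qed
  ultimately show ?thesis
    unfolding w_def[abs_def] by (rule borel_measurable_continuous_on_if) simp
qed

text \<open>The measure \<open>\<kappa>\<close> lives on Lebesgue sets. Through this map, Borel
  functions of the coordinates become measurable for \<open>\<kappa>\<close> and its
  product.\<close>

lemma ident_measurable: "(\<lambda>x. x) \<in> \<kappa> \<rightarrow>\<^sub>M borel"
  by (intro measurable_restrict_space1 measurable_completion) simp

lemma w_pair[measurable]: "w \<in> borel_measurable (\<kappa> \<Otimes>\<^sub>M \<kappa>)"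
proof -
  have "(\<lambda>p. (fst p, snd p)) \<in> \<kappa> \<Otimes>\<^sub>M \<kappa> \<rightarrow>\<^sub>M borel"
    by (intro borel_measurable_Pair measurable_compose[OF measurable_fst ident_measurable]
        measurable_compose[OF measurable_snd ident_measurable])
  from measurable_compose[OF this w_borel] show ?thesis by simp
qed

lemma w_slice[measurable]: "(\<lambda>y. w (x, y)) \<in> borel_measurable \<kappa>"
proof -
  have "(\<lambda>y. (x, y)) \<in> \<kappa> \<rightarrow>\<^sub>M borel"
    by (intro borel_measurable_Pair ident_measurable measurable_const) simp
  from measurable_compose[OF this w_borel] show ?thesis .
qed

lemma w_nonneg: "0 \<le> w p"
  by (simp add: w_def)

lemma w_le: "w p \<le> K"
  using \<sigma>_bound K_nonneg by (auto simp: w_def)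

lemma w_abs_le: "\<bar>w p\<bar> \<le> K"
  using w_nonneg w_le by simp

lemma emeasure_singleton: "emeasure \<kappa> {y} = 0" if "y \<in> {0..1}"
  using that by (subst emeasure_restrict_space) auto

lemma sets_singleton: "{y} \<in> sets \<kappa>" if "y \<in> {0..1}"
  using that by (auto simp: sets_restrict_space_iff)

text \<open>On a vertical line \<open>\<sigma>\<^sup>2\<close> and \<open>w\<close> differ at
  finitely many points only. The general \<open>k\<close> covers both the kernel of the fixed point
  equation and the truncated Hilbert kernel.\<close>

lemma slice_integral:
  fixes k :: "real \<Rightarrow> real \<Rightarrow> 'b::{banach, second_countable_topology}"
  assumes x: "x \<in> {0..1}"
  shows "(LINT y|\<kappa>. k y ((\<sigma> x y)\<^sup>2)) = (LINT y|\<kappa>. k y (w (x, y)))"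
proof (rule integral_discrete_difference[where X = "{y. (x, y) \<in> discontinuities \<sigma>}"])
  show "countable {y. (x, y) \<in> discontinuities \<sigma>}"
    using disc_finite[OF x] by (rule countable_finite)
  fix y
  show "emeasure \<kappa> {y} = 0" "{y} \<in> sets \<kappa>" if "y \<in> {y. (x, y) \<in> discontinuities \<sigma>}"
    using that by (auto simp: discontinuities_def intro: emeasure_singleton sets_singleton)
  show "k y ((\<sigma> x y)\<^sup>2) = k y (w (x, y))"
    if "y \<in> space \<kappa>" "y \<notin> {y. (x, y) \<in> discontinuities \<sigma>}"
    using that x by (simp add: w_def)
qed

text \<open>Along the range of \<open>f\<close> the slice is \<open>\<sigma>\<^sup>2\<close>, which
  differs from the measurable slice of \<open>w\<close> at finitely many points. This is the input
  required for pulling integrals back along \<open>f\<close>.\<close>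

lemma slice_measurable:
  assumes x: "x \<in> {0..1}"
  shows "(\<lambda>y. \<tau> (f x) (f y)) \<in> borel_measurable \<kappa>"
proof (rule measurable_discrete_difference[OF w_slice[of x], where X = "{y. (x, y) \<in> discontinuities \<sigma>}"])
  show "countable {y. (x, y) \<in> discontinuities \<sigma>}"
    using disc_finite[OF x] by (rule countable_finite)
  fix y
  show "{y} \<in> sets \<kappa>" if "y \<in> {y. (x, y) \<in> discontinuities \<sigma>}"
    using that by (auto simp: discontinuities_def intro: sets_singleton)
  show "w (x, y) = \<tau> (f x) (f y)"
    if "y \<in> space \<kappa>" "y \<notin> {y. (x, y) \<in> discontinuities \<sigma>}"
    using that x by (simp add: w_def \<tau>)
qed simp

text \<open>Through \<open>\<tau>\<close> the function \<open>\<sigma>\<^sup>2\<close> is symmetric,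
  but the discontinuity set of \<open>\<sigma>\<close>, where \<open>w\<close> is put to 0, need not
  be. It is null because its vertical sections are finite, and so is its mirror image.\<close>

lemma AE_w_swap: "AE p in \<kappa> \<Otimes>\<^sub>M \<kappa>. w (snd p, fst p) = w p"
proof -
  let ?D = "discontinuities \<sigma>"
  have D: "?D \<in> sets borel" using disc_closed by auto
  have "(\<lambda>p. (fst p, snd p)) \<in> \<kappa> \<Otimes>\<^sub>M \<kappa> \<rightarrow>\<^sub>M borel"
    by (intro borel_measurable_Pair measurable_compose[OF measurable_fst ident_measurable]
        measurable_compose[OF measurable_snd ident_measurable])
  from measurable_sets[OF this, of "- ?D"] D
  have m: "{p \<in> space (\<kappa> \<Otimes>\<^sub>M \<kappa>). p \<notin> ?D} \<in> sets (\<kappa> \<Otimes>\<^sub>M \<kappa>)"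
    by (simp add: vimage_def Int_def conj_commute)
  have 1: "AE p in \<kappa> \<Otimes>\<^sub>M \<kappa>. p \<notin> ?D"
  proof (rule unit2.AE_pair_measure[OF m], rule AE_I2)
    fix x assume x: "x \<in> space \<kappa>"
    let ?X = "{y. (x, y) \<in> ?D}"
    have "?X \<in> null_sets \<kappa>"
    proof (rule null_setsI)
      have "finite ?X" using x by (intro disc_finite) simp
      moreover have "?X \<subseteq> {0..1}" by (auto simp: discontinuities_def)
      ultimately show "emeasure \<kappa> ?X = 0" "?X \<in> sets \<kappa>"
      proof -
        assume X: "finite ?X" "?X \<subseteq> {0..1}"
        have "?X = (\<Union>y\<in>?X. {y})" by auto
        also have "\<dots> \<in> null_sets \<kappa>"
          using X by (intro null_sets_UN' countable_finite) (auto intro: emeasure_singleton sets_singleton)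
        finally show "emeasure \<kappa> ?X = 0" "?X \<in> sets \<kappa>" by auto
      qed
    qed
    then have "AE y in \<kappa>. y \<notin> ?X" by (rule AE_not_in)
    then show "AE y in \<kappa>. (x, y) \<notin> ?D" by simp
  qed
  \<comment> \<open>The product measure is invariant under exchange of coordinates, so the mirror
    image of the null set is null.\<close>
  have "AE p in distr (\<kappa> \<Otimes>\<^sub>M \<kappa>) (\<kappa> \<Otimes>\<^sub>M \<kappa>) (\<lambda>(x, y). (y, x)). p \<notin> ?D"
    using 1 by (subst unit2.distr_pair_swap[symmetric])
  then have 2: "AE p in \<kappa> \<Otimes>\<^sub>M \<kappa>. (\<lambda>(x, y). (y, x)) p \<notin> ?D"
    by (rule AE_distrD[rotated]) (rule measurable_pair_swap')
  have "AE p in \<kappa> \<Otimes>\<^sub>M \<kappa>. p \<in> space (\<kappa> \<Otimes>\<^sub>M \<kappa>)" by (rule AE_space)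
  with 1 2 show ?thesis
  proof eventually_elim
    case (elim p)
    then have "(\<sigma> (snd p) (fst p))\<^sup>2 = (\<sigma> (fst p) (snd p))\<^sup>2"
      by (cases p) (auto simp: space_pair_measure \<tau> intro: \<tau>_sym)
    then show ?case using elim by (cases p) (auto simp: w_def space_pair_measure)
  qed
qed

text \<open>The law of \<open>f\<close> has no atoms.\<close>

lemma AE_f_neq: "AE p in \<kappa> \<Otimes>\<^sub>M \<kappa>. f (fst p) \<noteq> f (snd p)"
proof (rule unit2.AE_pair_measure)
  show "{p \<in> space (\<kappa> \<Otimes>\<^sub>M \<kappa>). f (fst p) \<noteq> f (snd p)} \<in> sets (\<kappa> \<Otimes>\<^sub>M \<kappa>)"
    by measurable
  show "AE x in \<kappa>. AE y in \<kappa>. f (fst (x, y)) \<noteq> f (snd (x, y))"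
  proof (rule AE_I2)
    fix x
    have "AE t in lborel. t \<noteq> f x" by (rule AE_lborel_singleton)
    then have "AE y in \<kappa>. f y \<noteq> f x" by (rule AE_pullback)
    then show "AE y in \<kappa>. f (fst (x, y)) \<noteq> f (snd (x, y))" by eventually_elim auto
  qed
qed

section \<open>A priori bound and expansion in \<open>\<epsilon>\<close>\<close>

lemma bounded_integrable:
  fixes k :: "real \<Rightarrow> 'b::{banach, second_countable_topology}"
  assumes "k \<in> borel_measurable \<kappa>" "\<And>x. x \<in> {0..1} \<Longrightarrow> norm (k x) \<le> B"
  shows "integrable \<kappa> k"
  using assms by (intro unit.integrable_const_bound[where B = B] AE_I2) auto

lemma bounded_integral:
  fixes k :: "real \<Rightarrow> 'b::{banach, second_countable_topology}"
  assumes "k \<in> borel_measurable \<kappa>" "\<And>x. x \<in> {0..1} \<Longrightarrow> norm (k x) \<le> B"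
  shows "norm (LINT x|\<kappa>. k x) \<le> B"
proof -
  have "norm (LINT x|\<kappa>. k x) \<le> (LINT x|\<kappa>. B)"
    using bounded_integrable[OF assms] assms(2)
    by (intro Bochner_Integration.integral_norm_bound_integral) auto
  then show ?thesis using unit.prob_space by simp
qed

text \<open>As \<open>\<sigma>\<^sup>2\<close> is nonnegative and \<open>C\<close> has negative
  imaginary part, the integral term can only increase the imaginary part of the denominator, which
  is thus at least \<open>Im z\<close>.\<close>

lemma shlyakhtenko_transform_le:
  assumes "Im z > 0" "\<epsilon> \<ge> 0" "\<And>y. y \<in> {0..1} \<Longrightarrow> Im (C y) < 0"
    and eq: "C x = 1 / (z - of_real (f x) - of_real \<epsilon> * (LINT y|\<kappa>. of_real ((\<sigma> x y)\<^sup>2) * C y))"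
  shows "cmod (C x) \<le> 1 / Im z"
proof -
  let ?S = "LINT y|\<kappa>. complex_of_real ((\<sigma> x y)\<^sup>2) * C y"
  \<comment> \<open>If the integrand is not integrable, the integral has the default value 0 and the
    inequality still holds.\<close>
  have "Im ?S \<le> 0"
  proof (cases "integrable \<kappa> (\<lambda>y. complex_of_real ((\<sigma> x y)\<^sup>2) * C y)")
    case True
    then have "Im ?S = (LINT y|\<kappa>. Im (complex_of_real ((\<sigma> x y)\<^sup>2) * C y))"
      by (rule integral_Im[symmetric])
    also have "\<dots> \<le> (LINT y|\<kappa>. 0)"
      using integrable_Im[OF True] assms(3)
      by (intro integral_mono) (auto simp: mult_nonneg_nonpos less_imp_le simp del: of_real_power)
    finally show ?thesis by simp
  qed (simp add: not_integrable_integral_eq)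
  then have "Im z \<le> Im (z - of_real (f x) - of_real \<epsilon> * ?S)"
    using assms(2) by (simp add: mult_nonneg_nonpos)
  also have "\<dots> \<le> cmod (z - of_real (f x) - of_real \<epsilon> * ?S)"
    using abs_Im_le_cmod abs_ge_self order_trans by blast
  finally show ?thesis using assms(1) unfolding eq by (simp add: norm_divide frac_le)
qed

text \<open>This is the coefficient of \<open>\<epsilon>\<close>, written with \<open>w\<close>
  instead of \<open>\<sigma>\<^sup>2\<close> so that the double integral has a jointly measurable
  integrand.\<close>

definition second_order :: "complex \<Rightarrow> complex" where
  "second_order z = (LINT x|\<kappa>. (LINT y|\<kappa>. of_real (w (x, y)) * cauchy_kernel z (f y)) * (cauchy_kernel z (f x))\<^sup>2)"

text \<open>The equation gives \<open>c - g = \<epsilon> S c g\<close>. Replacing \<open>S\<close>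
  and \<open>c\<close> on the right by \<open>S0\<close> and \<open>g\<close> costs another factor
  \<open>\<epsilon>\<close>, by the a priori bound \<open>1 / Im z\<close>.\<close>

lemma transform_expansion:
  assumes tr: "has_shlyakhtenko_transform \<sigma> f \<epsilon> \<nu>" and \<epsilon>: "0 < \<epsilon>" and z: "Im z > 0"
  shows "cmod ((LINT t|\<nu>. cauchy_kernel z t) - (LINT x|\<kappa>. cauchy_kernel z (f x)) - of_real \<epsilon> * second_order z)
    \<le> 2 * K\<^sup>2 / (Im z)^5 * \<epsilon>\<^sup>2"
proof -
  define b where "b = Im z"
  have b: "b > 0" using z by (simp add: b_def)
  define g where "g x = cauchy_kernel z (f x)" for x
  obtain C where C: "\<And>z. Im z > 0 \<Longrightarrow> (\<lambda>x. C x z) \<in> borel_measurable \<kappa>"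
      "\<And>x z. x \<in> {0..1} \<Longrightarrow> Im z > 0 \<Longrightarrow> Im (C x z) < 0"
      "\<And>x z. x \<in> {0..1} \<Longrightarrow> Im z > 0 \<Longrightarrow> C x z = 1 / (z - complex_of_real (f x) - complex_of_real \<epsilon> *
             (LINT y|\<kappa>. complex_of_real ((\<sigma> x y)\<^sup>2) * C y z))"
      "\<And>z. Im z > 0 \<Longrightarrow> (LINT t|\<nu>. cauchy_kernel z t) = (LINT x|\<kappa>. C x z)"
    using tr unfolding has_shlyakhtenko_transform_def by blast
  define c where "c x = C x z" for x
  have cm[measurable]: "c \<in> borel_measurable \<kappa>" using C(1)[OF z] by (simp add: c_def[abs_def])
  have gm[measurable]: "g \<in> borel_measurable \<kappa>"
    unfolding g_def by (rule measurable_compose[OF f_measurable cauchy_kernel_measurable])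
  define S where "S x = (LINT y|\<kappa>. complex_of_real (w (x, y)) * c y)" for x
  define S0 where "S0 x = (LINT y|\<kappa>. complex_of_real (w (x, y)) * g y)" for x
  have cb: "cmod (c x) \<le> 1 / b" if "x \<in> {0..1}" for x
    unfolding c_def b_def
    by (rule shlyakhtenko_transform_le[where C = "\<lambda>x. C x z", OF z _ _ C(3)[OF that z]])
       (use \<epsilon> C(2) z in auto)
  have gb: "cmod (g x) \<le> 1 / b" for x
    unfolding g_def b_def by (rule cauchy_kernel_le[OF z])
  have wb: "cmod (complex_of_real (w p) * u) \<le> K * B" if "cmod u \<le> B" for p u B
    using w_abs_le[of p] that by (simp add: norm_mult mult_mono K_nonneg)
  have Sb: "cmod (S x) \<le> K * (1 / b)" for x
    unfolding S_def by (intro bounded_integral wb cb) measurable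
  have S0b: "cmod (S0 x) \<le> K * (1 / b)" for x
    unfolding S0_def by (intro bounded_integral wb gb) measurable
  have Sm[measurable]: "S \<in> borel_measurable \<kappa>" "S0 \<in> borel_measurable \<kappa>"
    unfolding S_def S0_def by measurable
  \<comment> \<open>This is the difference of two reciprocals,
    \<open>1 / (A - B) - 1 / A = B / ((A - B) * A)\<close>. The denominator \<open>A - B\<close> is
    nonzero because \<open>c x\<close> is nonzero, its imaginary part being negative.\<close>
  have fix_eq: "c x - g x = of_real \<epsilon> * S x * c x * g x" if x: "x \<in> {0..1}" for x
  proof -
    have c: "c x = 1 / (z - of_real (f x) - of_real \<epsilon> * S x)"
      unfolding c_def S_def
      using C(3)[OF x z] slice_integral[OF x, of "\<lambda>y v. complex_of_real v * C y z"]
      by (simp only:)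
    have "Im (c x) < 0" unfolding c_def using C(2)[OF x z] .
    then have "c x \<noteq> 0" by auto
    then have 1: "z - of_real (f x) - of_real \<epsilon> * S x \<noteq> 0" using c by auto
    have 2: "z - of_real (f x) \<noteq> 0" by (rule minus_of_real_nonzero[OF z])
    show ?thesis
      unfolding c g_def cauchy_kernel_def using 1 2 by (simp add: field_simps)
  qed
  have diff: "cmod (c x - g x) \<le> \<epsilon> * K / b^3" if x: "x \<in> {0..1}" for x
  proof -
    have "cmod (c x - g x) = \<epsilon> * cmod (S x) * cmod (c x) * cmod (g x)"
      using fix_eq[OF x] \<epsilon> by (simp add: norm_mult)
    also have "\<dots> \<le> \<epsilon> * (K * (1 / b)) * (1 / b) * (1 / b)"
      using \<epsilon> b K_nonneg Sb cb[OF x] gb by (intro mult_mono) auto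
    finally show ?thesis by (simp add: power3_eq_cube)
  qed
  have Sdiff: "cmod (S x - S0 x) \<le> K * (\<epsilon> * K / b^3)" for x
  proof -
    have "S x - S0 x = (LINT y|\<kappa>. complex_of_real (w (x, y)) * c y - complex_of_real (w (x, y)) * g y)"
      unfolding S_def S0_def
      by (rule Bochner_Integration.integral_diff[symmetric];
          rule bounded_integrable[where B = "K * (1 / b)"]; (intro wb cb gb)?; measurable)
    also have "\<dots> = (LINT y|\<kappa>. complex_of_real (w (x, y)) * (c y - g y))"
      by (simp add: right_diff_distrib)
    also have "cmod \<dots> \<le> K * (\<epsilon> * K / b^3)"
      by (intro bounded_integral wb diff) measurable
    finally show ?thesis .
  qed
  have main: "cmod (c x - g x - of_real \<epsilon> * (S0 x * (g x)\<^sup>2)) \<le> 2 * K\<^sup>2 / b^5 * \<epsilon>\<^sup>2" if x: "x \<in> {0..1}" for x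
  proof -
    have eq: "c x - g x - of_real \<epsilon> * (S0 x * (g x)\<^sup>2) =
        of_real \<epsilon> * g x * ((S x - S0 x) * c x + S0 x * (c x - g x))"
    proof -
      have "c x - g x - of_real \<epsilon> * (S0 x * (g x)\<^sup>2) =
          of_real \<epsilon> * S x * c x * g x - of_real \<epsilon> * (S0 x * (g x)\<^sup>2)"
        using fix_eq[OF x] by simp
      also have "\<dots> = of_real \<epsilon> * g x * ((S x - S0 x) * c x + S0 x * (c x - g x))"
        by (simp add: algebra_simps power2_eq_square)
      finally show ?thesis .
    qed
    \<comment> \<open>Each of the two products is at most
      \<open>\<epsilon> * K\<^sup>2 / b^4\<close>. The outer factor \<open>\<epsilon> * g x\<close>
      supplies the remaining \<open>\<epsilon> / b\<close>, hence the constant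
      \<open>2 * K\<^sup>2 / b^5\<close>.\<close>
    have "cmod ((S x - S0 x) * c x + S0 x * (c x - g x)) \<le>
        K * (\<epsilon> * K / b^3) * (1 / b) + K * (1 / b) * (\<epsilon> * K / b^3)"
      using \<epsilon> b K_nonneg
      by (intro order_trans[OF norm_triangle_ineq] add_mono; unfold norm_mult;
          intro mult_mono Sdiff cb x S0b diff) auto
    then have "\<epsilon> * cmod (g x) * cmod ((S x - S0 x) * c x + S0 x * (c x - g x)) \<le>
       \<epsilon> * (1 / b) * (K * (\<epsilon> * K / b^3) * (1 / b) + K * (1 / b) * (\<epsilon> * K / b^3))"
      using \<epsilon> b K_nonneg gb by (intro mult_mono) auto
    also have "\<dots> = 2 * K\<^sup>2 / b^5 * \<epsilon>\<^sup>2"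
      using b by (simp add: field_simps power2_eq_square eval_nat_numeral)
    finally show ?thesis unfolding eq using \<epsilon> by (simp add: norm_mult)
  qed
  have i: "integrable \<kappa> c" "integrable \<kappa> g" "integrable \<kappa> (\<lambda>x. S0 x * (g x)\<^sup>2)"
  proof -
    show "integrable \<kappa> c" by (rule bounded_integrable[OF cm cb])
    show "integrable \<kappa> g" by (rule bounded_integrable[OF gm gb])
    have "cmod (S0 x * (g x)\<^sup>2) \<le> K * (1 / b) * (1 / b)\<^sup>2" for x
      unfolding norm_mult norm_power using b K_nonneg gb S0b by (intro mult_mono power_mono) auto
    then show "integrable \<kappa> (\<lambda>x. S0 x * (g x)\<^sup>2)"
      by (intro bounded_integrable) measurable
  qed
  have "(LINT t|\<nu>. cauchy_kernel z t) - (LINT x|\<kappa>. g x) - of_real \<epsilon> * second_order z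
     = (LINT x|\<kappa>. c x - g x - of_real \<epsilon> * (S0 x * (g x)\<^sup>2))"
    using i C(4)[OF z] unfolding second_order_def S0_def[symmetric] g_def[symmetric] c_def[symmetric]
    by simp
  also have "cmod \<dots> \<le> 2 * K\<^sup>2 / b^5 * \<epsilon>\<^sup>2"
    by (intro bounded_integral main) measurable
  finally show ?thesis unfolding g_def b_def .
qed

end

section \<open>The Hilbert transform term\<close>

context band_profile
begin

text \<open>This is the truncated Hilbert transform at the point \<open>f x\<close>, written over
  the unit interval so that measurability in \<open>x\<close> follows from that of
  \<open>w\<close>.\<close>

definition trunc_hilbert :: "real \<Rightarrow> real \<Rightarrow> real" where
  "trunc_hilbert x \<eta> = (LINT y|\<kappa>. w (x, y) * (if \<eta> < \<bar>f x - f y\<bar> then 1 / (f x - f y) else 0))"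

lemma trunc_hilbert_measurable[measurable]: "(\<lambda>x. trunc_hilbert x \<eta>) \<in> borel_measurable \<kappa>"
  unfolding trunc_hilbert_def by measurable

text \<open>The integral is pulled back along \<open>f\<close> with \<open>\<tau> (f x)\<close> as
  the real factor and the truncated kernel as the Borel factor; then \<open>\<sigma>\<^sup>2\<close>
  is replaced by \<open>w\<close> on the slice.\<close>

lemma trunc_hilbert_eq:
  assumes x: "x \<in> {0..1}"
  shows "set_lebesgue_integral lebesgue {t. \<bar>f x - t\<bar> > \<eta>} (\<lambda>t. \<tau> (f x) t * \<rho> t / (f x - t)) = trunc_hilbert x \<eta>"
proof -
  let ?k = "\<lambda>t. if \<eta> < \<bar>f x - t\<bar> then 1 / (f x - t) else 0"
  have "set_lebesgue_integral lebesgue {t. \<bar>f x - t\<bar> > \<eta>} (\<lambda>t. \<tau> (f x) t * \<rho> t / (f x - t)) =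
      (LINT t|lebesgue. (\<rho> t * \<tau> (f x) t) *\<^sub>R ?k t)"
    unfolding set_lebesgue_integral_def
    by (intro Bochner_Integration.integral_cong) (auto simp: indicator_def)
  also have "\<dots> = (LINT y|\<kappa>. \<tau> (f x) (f y) *\<^sub>R ?k (f y))"
    by (intro pullback_integral slice_measurable x) measurable
  also have "\<dots> = (LINT y|\<kappa>. (\<sigma> x y)\<^sup>2 * ?k (f y))"
    using x by (intro Bochner_Integration.integral_cong) (auto simp: \<tau>)
  also have "\<dots> = trunc_hilbert x \<eta>"
    unfolding trunc_hilbert_def by (rule slice_integral[OF x])
  finally show ?thesis .
qed

lemma slice_le:
  assumes "x \<in> {0..1}" "y \<in> {0..1}"
  shows "\<bar>\<tau> (f x) (f y)\<bar> \<le> K"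
  using \<sigma>_bound[OF assms] \<tau>[OF assms] zero_le_power2[of "\<sigma> x y"] by simp

text \<open>Pulled back to the probability measure \<open>\<kappa>\<close>, the integrand is bounded
  by \<open>K\<close>. The second claim makes the far part of the principal value uniformly bounded
  in \<open>x\<close>.\<close>

lemma slice_density_integrable:
  assumes x: "x \<in> {0..1}"
  shows "integrable lebesgue (\<lambda>t. \<tau> (f x) t * \<rho> t)" "(LINT t|lebesgue. \<bar>\<tau> (f x) t * \<rho> t\<bar>) \<le> K"
proof -
  have "integrable \<kappa> (\<lambda>y. \<tau> (f x) (f y) *\<^sub>R (1::real))"
    using slice_measurable[OF x] slice_le[OF x] by (intro bounded_integrable[where B = K]) auto
  then have "integrable lebesgue (\<lambda>t. (\<rho> t * \<tau> (f x) t) *\<^sub>R (1::real))"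
    by (subst pullback_integral(2)) (auto intro: slice_measurable x)
  then show "integrable lebesgue (\<lambda>t. \<tau> (f x) t * \<rho> t)"
    by (simp add: mult.commute)
  have m: "(\<lambda>y. \<bar>\<tau> (f x) (f y)\<bar>) \<in> borel_measurable \<kappa>"
    by (intro borel_measurable_abs slice_measurable x)
  have "(LINT t|lebesgue. \<bar>\<tau> (f x) t * \<rho> t\<bar>) = (LINT t|lebesgue. (\<rho> t * \<bar>\<tau> (f x) t\<bar>) *\<^sub>R 1)"
    using \<rho>_nonneg by (intro Bochner_Integration.integral_cong) (auto simp: abs_mult)
  also have "\<dots> = (LINT y|\<kappa>. \<bar>\<tau> (f x) (f y)\<bar> *\<^sub>R 1)"
    by (intro pullback_integral m) simp
  also have "\<dots> \<le> norm \<dots>" by simp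
  also have "\<dots> \<le> K"
    using m slice_le[OF x] by (intro bounded_integral) auto
  finally show "(LINT t|lebesgue. \<bar>\<tau> (f x) t * \<rho> t\<bar>) \<le> K" .
qed

end

section \<open>Convergence and uniform bounds for the truncated transforms\<close>

locale Hoelder_profile = band_profile +
  fixes \<eta>\<^sub>0 \<alpha> C :: real
  assumes \<eta>\<^sub>0_pos: "\<eta>\<^sub>0 > 0"
    and \<alpha>_pos: "\<alpha> > 0"
    and hoelder: "AE s in lborel. \<forall>t\<in>{s - \<eta>\<^sub>0..s + \<eta>\<^sub>0}.
           \<bar>\<tau> s t * \<rho> t - \<tau> s s * \<rho> s\<bar> \<le> C * \<bar>t - s\<bar> powr \<alpha>"
begin

text \<open>This is the bound for principal values of Hoelder functions with radius
  \<open>\<eta>\<^sub>0\<close> and with \<open>K\<close> in place of the \<open>L\<^sup>1\<close>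
  norm, so that it is independent of \<open>x\<close>.\<close>

definition hilbert_bound :: real where
  "hilbert_bound = C * (LINT t|lborel. indicator {-\<eta>\<^sub>0..\<eta>\<^sub>0} t * \<bar>t\<bar> powr (\<alpha> - 1)) + K / \<eta>\<^sub>0"

abbreviation Ht :: "real \<Rightarrow> real" where
  "Ht s \<equiv> hilbert_transform (\<lambda>t. \<tau> s t * \<rho> t) s"

text \<open>The Hoelder condition holds for almost every \<open>s\<close>, hence at
  \<open>s = f x\<close> for almost every \<open>x\<close>, because the law of \<open>f\<close> has
  a density. There the principal value exists, so \<open>Lim\<close> returns it.\<close>

lemma AE_trunc_hilbert:
  "AE x in \<kappa>. (trunc_hilbert x \<longlongrightarrow> Ht (f x)) (at_right 0) \<and>
     (\<forall>\<eta>. 0 < \<eta> \<longrightarrow> \<eta> < \<eta>\<^sub>0 \<longrightarrow> \<bar>trunc_hilbert x \<eta>\<bar> \<le> hilbert_bound)"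
  using AE_pullback[OF hoelder] AE_space
proof eventually_elim
  case (elim x)
  then have x: "x \<in> {0..1}" by simp
  let ?\<phi> = "\<lambda>t. \<tau> (f x) t * \<rho> t"
  have h: "\<bar>?\<phi> t - ?\<phi> (f x)\<bar> \<le> C * \<bar>t - f x\<bar> powr \<alpha>" if "t \<in> {f x - \<eta>\<^sub>0..f x + \<eta>\<^sub>0}" for t
    using elim(1) that by blast
  note pv = principal_value_Hoelder[OF slice_density_integrable(1)[OF x] \<eta>\<^sub>0_pos \<alpha>_pos h,
      unfolded trunc_hilbert_eq[OF x]]
  obtain l where l: "(trunc_hilbert x \<longlongrightarrow> l) (at_right 0)"
    using pv(1) by auto
  have "Ht (f x) = l"
    unfolding hilbert_transform_def trunc_hilbert_eq[OF x]
    using l by (intro tendsto_Lim) auto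
  moreover have "\<bar>trunc_hilbert x \<eta>\<bar> \<le> hilbert_bound" if "0 < \<eta>" "\<eta> < \<eta>\<^sub>0" for \<eta>
  proof -
    have "(LINT t|lebesgue. \<bar>?\<phi> t\<bar>) / \<eta>\<^sub>0 \<le> K / \<eta>\<^sub>0"
      using slice_density_integrable(2)[OF x] \<eta>\<^sub>0_pos by (intro divide_right_mono) auto
    then show ?thesis using pv(2)[OF _ that] by (simp add: hilbert_bound_def)
  qed
  ultimately show ?case using l by simp
qed

text \<open>A sequence of truncations suits dominated convergence. The summand 2 keeps it strictly
  below \<open>\<eta>\<^sub>0\<close> even for \<open>n = 0\<close>.\<close>

definition cutoff :: "nat \<Rightarrow> real" where
  "cutoff n = \<eta>\<^sub>0 / (real n + 2)"

lemma cutoff: "0 < cutoff n" "cutoff n < \<eta>\<^sub>0" "filterlim cutoff (at_right 0) sequentially"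
proof -
  show "0 < cutoff n" for n using \<eta>\<^sub>0_pos by (simp add: cutoff_def)
  moreover have "cutoff \<longlonglongrightarrow> 0"
    unfolding cutoff_def by real_asymp
  ultimately show "filterlim cutoff (at_right 0) sequentially"
    by (auto simp: filterlim_at less_imp_neq[symmetric] intro!: always_eventually)
  have "\<eta>\<^sub>0 * 1 < \<eta>\<^sub>0 * (real n + 2)" using \<eta>\<^sub>0_pos by (intro mult_strict_left_mono) auto
  then show "cutoff n < \<eta>\<^sub>0" by (simp add: cutoff_def divide_less_eq)
qed

lemma Ht_AE:
  "AE x in \<kappa>. (\<lambda>n. trunc_hilbert x (cutoff n)) \<longlonglongrightarrow> Ht (f x)"
  "AE x in \<kappa>. \<bar>trunc_hilbert x (cutoff n)\<bar> \<le> hilbert_bound"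
proof -
  show "AE x in \<kappa>. (\<lambda>n. trunc_hilbert x (cutoff n)) \<longlonglongrightarrow> Ht (f x)"
    using AE_trunc_hilbert by eventually_elim (auto intro: filterlim_compose[OF _ cutoff(3)])
  show "AE x in \<kappa>. \<bar>trunc_hilbert x (cutoff n)\<bar> \<le> hilbert_bound"
    using AE_trunc_hilbert by eventually_elim (use cutoff in auto)
qed

text \<open>Almost everywhere it is the limit of measurable truncated transforms, and
  \<open>\<kappa>\<close> is complete.\<close>

lemma Ht_measurable[measurable]: "(\<lambda>x. Ht (f x)) \<in> borel_measurable \<kappa>"
proof (rule complete_measure.borel_measurable_cong_AE)
  show "complete_measure \<kappa>" by (intro complete_measure_restrict_completion) simp
  show "(\<lambda>x. lim (\<lambda>n. trunc_hilbert x (cutoff n))) \<in> borel_measurable \<kappa>"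
    by (intro borel_measurable_lim_metric) simp
  show "AE x in \<kappa>. lim (\<lambda>n. trunc_hilbert x (cutoff n)) = Ht (f x)"
    using Ht_AE(1) by eventually_elim (rule limI)
qed

text \<open>Measurability is known for \<open>Ht\<close> composed with \<open>f\<close>; Lusin's
  theorem transfers it to the line once \<open>Ht\<close> is multiplied by
  \<open>\<rho>\<close>.\<close>

lemma first_order_term_measurable: "first_order_term \<rho> \<tau> \<in> borel_measurable lebesgue"
proof -
  have "(\<lambda>t. \<rho> t * (- Ht t)) \<in> borel_measurable lebesgue"
    by (rule pullback_measurable) measurable
  then show ?thesis by (simp add: first_order_term_def[abs_def])
qed

section \<open>Symmetrization over the unit square\<close>

lemma pair_integrable:
  fixes k :: "real \<times> real \<Rightarrow> 'b::{banach, second_countable_topology}"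
  assumes "k \<in> borel_measurable (\<kappa> \<Otimes>\<^sub>M \<kappa>)" "\<And>p. norm (k p) \<le> B"
  shows "integrable (\<kappa> \<Otimes>\<^sub>M \<kappa>) k"
  using assms by (intro unit2.P.integrable_const_bound[where B = B] AE_I2) auto

lemma pair_integral_swap:
  fixes k :: "real \<times> real \<Rightarrow> 'b::{banach, second_countable_topology}"
  assumes [measurable]: "k \<in> borel_measurable (\<kappa> \<Otimes>\<^sub>M \<kappa>)"
  shows "(LINT p|(\<kappa> \<Otimes>\<^sub>M \<kappa>). k (snd p, fst p)) = (LINT p|(\<kappa> \<Otimes>\<^sub>M \<kappa>). k p)"
  using unit2.integral_product_swap[OF assms] by (simp add: case_prod_beta')

text \<open>Antisymmetry of \<open>1/(s - t)\<close> turns the square of the kernel into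
  \<open>(g(s)\<^sup>2 - g(t)\<^sup>2)/(s - t) = g(s) g(t) (g(s) + g(t))\<close>, which has no singularity.\<close>

lemma truncated_symmetrization:
  assumes z: "Im z > 0" and \<eta>: "\<eta> > 0"
  defines "g \<equiv> \<lambda>x. cauchy_kernel z (f x)"
  shows "(LINT x|\<kappa>. trunc_hilbert x \<eta> *\<^sub>R (g x)\<^sup>2) =
    (LINT p|(\<kappa> \<Otimes>\<^sub>M \<kappa>). (w p * (if \<eta> < \<bar>f (fst p) - f (snd p)\<bar> then 1 else 0)) *\<^sub>R
       (g (fst p) * g (snd p) * (g (fst p) + g (snd p)))) / 2"
proof -
  have gm[measurable]: "g \<in> borel_measurable \<kappa>"
    unfolding g_def by (rule measurable_compose[OF f_measurable cauchy_kernel_measurable])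
  define k where "k p = (if \<eta> < \<bar>f (fst p) - f (snd p)\<bar> then 1 / (f (fst p) - f (snd p)) else 0)" for p
  have km[measurable]: "k \<in> borel_measurable (\<kappa> \<Otimes>\<^sub>M \<kappa>)" unfolding k_def by measurable
  have kb: "\<bar>k p\<bar> \<le> 1 / \<eta>" for p
    using \<eta> by (auto simp: k_def intro!: frac_le)
  have gb: "cmod ((g x)\<^sup>2) \<le> (1 / Im z)\<^sup>2" for x
    unfolding g_def norm_power by (intro power_mono cauchy_kernel_le[OF z]) simp
  have b: "cmod ((w p * k p) *\<^sub>R (g x)\<^sup>2) \<le> K * (1 / \<eta>) * (1 / Im z)\<^sup>2" for p x
    unfolding norm_scaleR abs_mult using kb gb w_abs_le K_nonneg \<eta> by (intro mult_mono) auto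
  let ?G1 = "\<lambda>p. (w p * k p) *\<^sub>R (g (fst p))\<^sup>2" and ?G2 = "\<lambda>p. (w p * k p) *\<^sub>R (g (snd p))\<^sup>2"
  have i1: "integrable (\<kappa> \<Otimes>\<^sub>M \<kappa>) ?G1" by (rule pair_integrable[OF _ b]) measurable
  have i2: "integrable (\<kappa> \<Otimes>\<^sub>M \<kappa>) ?G2" by (rule pair_integrable[OF _ b]) measurable
  have "(LINT x|\<kappa>. trunc_hilbert x \<eta> *\<^sub>R (g x)\<^sup>2) = (LINT x|\<kappa>. LINT y|\<kappa>. ?G1 (x, y))"
  proof (intro Bochner_Integration.integral_cong refl)
    fix x
    have "integrable \<kappa> (\<lambda>y. w (x, y) * k (x, y))"
    proof (rule bounded_integrable)
      show "(\<lambda>y. w (x, y) * k (x, y)) \<in> borel_measurable \<kappa>"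
        unfolding k_def fst_conv snd_conv by measurable
      show "norm (w (x, y) * k (x, y)) \<le> K * (1 / \<eta>)" for y
        unfolding norm_mult using kb[of "(x, y)"] w_abs_le[of "(x, y)"] K_nonneg
        by (intro mult_mono) auto
    qed
    then show "trunc_hilbert x \<eta> *\<^sub>R (g x)\<^sup>2 = (LINT y|\<kappa>. ?G1 (x, y))"
      unfolding trunc_hilbert_def k_def fst_conv snd_conv by simp
  qed
  also have "\<dots> = (LINT p|(\<kappa> \<Otimes>\<^sub>M \<kappa>). ?G1 p)"
    by (rule unit2.integral_fst'[OF i1])
  finally have 1: "(LINT x|\<kappa>. trunc_hilbert x \<eta> *\<^sub>R (g x)\<^sup>2) = (LINT p|(\<kappa> \<Otimes>\<^sub>M \<kappa>). ?G1 p)" .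
  \<comment> \<open>Under exchange of coordinates \<open>w\<close> is invariant almost everywhere
    and \<open>k\<close> changes sign, so the integral of \<open>?G1\<close> is minus that of
    \<open>?G2\<close>, that is, half the integral of \<open>?G1 - ?G2\<close>.\<close>
  have "(LINT p|(\<kappa> \<Otimes>\<^sub>M \<kappa>). ?G1 p) = (LINT p|(\<kappa> \<Otimes>\<^sub>M \<kappa>). ?G1 (snd p, fst p))"
    by (rule pair_integral_swap[symmetric]) measurable
  also have "\<dots> = (LINT p|(\<kappa> \<Otimes>\<^sub>M \<kappa>). - ?G2 p)"
  proof (rule integral_cong_AE)
    have [measurable]: "(\<lambda>p. w (snd p, fst p)) \<in> borel_measurable (\<kappa> \<Otimes>\<^sub>M \<kappa>)"
      "(\<lambda>p. k (snd p, fst p)) \<in> borel_measurable (\<kappa> \<Otimes>\<^sub>M \<kappa>)"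
      by measurable
    show "(\<lambda>p. ?G1 (snd p, fst p)) \<in> borel_measurable (\<kappa> \<Otimes>\<^sub>M \<kappa>)" by simp
    show "(\<lambda>p. - ?G2 p) \<in> borel_measurable (\<kappa> \<Otimes>\<^sub>M \<kappa>)" by measurable
    show "AE p in \<kappa> \<Otimes>\<^sub>M \<kappa>. ?G1 (snd p, fst p) = - ?G2 p"
      using AE_w_swap
    proof eventually_elim
      case (elim p)
      have "k (snd p, fst p) = - k p"
        by (simp add: k_def abs_minus_commute minus_divide_right)
      then show ?case using elim by simp
    qed
  qed
  finally have "2 * (LINT p|(\<kappa> \<Otimes>\<^sub>M \<kappa>). ?G1 p) = (LINT p|(\<kappa> \<Otimes>\<^sub>M \<kappa>). ?G1 p - ?G2 p)"
    using i1 i2 by simp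
  also have "\<dots> = (LINT p|(\<kappa> \<Otimes>\<^sub>M \<kappa>). (w p * (if \<eta> < \<bar>f (fst p) - f (snd p)\<bar> then 1 else 0)) *\<^sub>R
       (g (fst p) * g (snd p) * (g (fst p) + g (snd p))))"
  proof (intro Bochner_Integration.integral_cong refl)
    fix p
    show "?G1 p - ?G2 p = (w p * (if \<eta> < \<bar>f (fst p) - f (snd p)\<bar> then 1 else 0)) *\<^sub>R
       (g (fst p) * g (snd p) * (g (fst p) + g (snd p)))"
    proof (cases "\<eta> < \<bar>f (fst p) - f (snd p)\<bar>")
      case True
      define s t where "s = f (fst p)" and "t = f (snd p)"
      have ne: "s \<noteq> t" using True \<eta> by (auto simp: s_def t_def)
      have "cauchy_kernel z s - cauchy_kernel z t = of_real (s - t) * (cauchy_kernel z s * cauchy_kernel z t)"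
        unfolding cauchy_kernel_def 
        using minus_of_real_nonzero[OF z, of s] minus_of_real_nonzero[OF z, of t] by (simp add: field_simps)
      note diff = this
      have "(cauchy_kernel z s)\<^sup>2 - (cauchy_kernel z t)\<^sup>2 =
          (cauchy_kernel z s - cauchy_kernel z t) * (cauchy_kernel z s + cauchy_kernel z t)"
        by (simp add: power2_eq_square algebra_simps)
      then have "(cauchy_kernel z s)\<^sup>2 - (cauchy_kernel z t)\<^sup>2 =
          of_real (s - t) * (cauchy_kernel z s * cauchy_kernel z t * (cauchy_kernel z s + cauchy_kernel z t))"
        unfolding diff by (simp only: mult.assoc)
      then have "(1 / (s - t)) *\<^sub>R ((cauchy_kernel z s)\<^sup>2 - (cauchy_kernel z t)\<^sup>2) =
          cauchy_kernel z s * cauchy_kernel z t * (cauchy_kernel z s + cauchy_kernel z t)"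
        using ne by (simp add: scaleR_conv_of_real)
      note kernel = this
      have kp: "k p = 1 / (s - t)" using True by (simp add: k_def s_def t_def)
      have "?G1 p - ?G2 p = w p *\<^sub>R ((1 / (s - t)) *\<^sub>R ((cauchy_kernel z s)\<^sup>2 - (cauchy_kernel z t)\<^sup>2))"
        unfolding kp g_def s_def[symmetric] t_def[symmetric] scaleR_diff_right scaleR_scaleR ..
      then show ?thesis
        unfolding kernel g_def s_def[symmetric] t_def[symmetric] using True by (simp add: s_def t_def)
    qed (simp add: k_def)
  qed
  finally have 2: "2 * (LINT p|(\<kappa> \<Otimes>\<^sub>M \<kappa>). ?G1 p) = \<dots>" .
  show ?thesis unfolding 1 2[symmetric] by simp
qed

text \<open>The truncation is removed on both sides of the symmetrized identity: on the left by the
  uniform bound on the truncated transforms, on the right because the integrand is bounded. A second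
  use of symmetry absorbs the factor 1/2.\<close>

lemma Ht_integral_eq_second_order:
  assumes z: "Im z > 0"
  shows "(LINT x|\<kappa>. Ht (f x) *\<^sub>R (cauchy_kernel z (f x))\<^sup>2) = second_order z"
proof -
  define g where "g x = cauchy_kernel z (f x)" for x
  have gm[measurable]: "g \<in> borel_measurable \<kappa>"
    unfolding g_def by (rule measurable_compose[OF f_measurable cauchy_kernel_measurable])
  have gb: "cmod (g x) \<le> 1 / Im z" for x
    unfolding g_def by (rule cauchy_kernel_le[OF z])
  have gb2: "cmod ((g x)\<^sup>2) \<le> (1 / Im z)\<^sup>2" for x
    unfolding norm_power by (intro power_mono gb) simp
  let ?Q = "\<lambda>p. g (fst p) * g (snd p) * (g (fst p) + g (snd p))"
  have Qb: "cmod (?Q p) \<le> (1 / Im z) * (1 / Im z) * (1 / Im z + 1 / Im z)" for p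
    unfolding norm_mult using z
    by (intro mult_mono gb order_trans[OF norm_triangle_ineq] add_mono) auto
  let ?R = "\<lambda>n p. (w p * (if cutoff n < \<bar>f (fst p) - f (snd p)\<bar> then 1 else 0)) *\<^sub>R ?Q p"
  have "(\<lambda>n. LINT x|\<kappa>. trunc_hilbert x (cutoff n) *\<^sub>R (g x)\<^sup>2) \<longlonglongrightarrow> (LINT x|\<kappa>. Ht (f x) *\<^sub>R (g x)\<^sup>2)"
  proof (rule integral_dominated_convergence)
    show "AE x in \<kappa>. (\<lambda>n. trunc_hilbert x (cutoff n) *\<^sub>R (g x)\<^sup>2) \<longlonglongrightarrow> Ht (f x) *\<^sub>R (g x)\<^sup>2"
      using Ht_AE(1) by eventually_elim (intro tendsto_intros)
    show "AE x in \<kappa>. norm (trunc_hilbert x (cutoff n) *\<^sub>R (g x)\<^sup>2) \<le> hilbert_bound * (1 / Im z)\<^sup>2" for n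
      using Ht_AE(2)[of n]
    proof eventually_elim
      case (elim x)
      then show ?case unfolding norm_scaleR using gb2[of x] by (intro mult_mono) auto
    qed
  qed measurable
  moreover have "(\<lambda>n. LINT x|\<kappa>. trunc_hilbert x (cutoff n) *\<^sub>R (g x)\<^sup>2) = (\<lambda>n. (LINT p|(\<kappa> \<Otimes>\<^sub>M \<kappa>). ?R n p) / 2)"
    unfolding g_def by (intro ext truncated_symmetrization[OF z cutoff(1)])
  moreover have "(\<lambda>n. (LINT p|(\<kappa> \<Otimes>\<^sub>M \<kappa>). ?R n p) / 2) \<longlonglongrightarrow> (LINT p|(\<kappa> \<Otimes>\<^sub>M \<kappa>). w p *\<^sub>R ?Q p) / 2"
  proof (intro tendsto_divide tendsto_const, rule integral_dominated_convergence)
    \<comment> \<open>For almost all pairs \<open>f\<close> takes distinct values, so the indicator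
      is eventually 1.\<close>
    show "AE p in \<kappa> \<Otimes>\<^sub>M \<kappa>. (\<lambda>n. ?R n p) \<longlonglongrightarrow> w p *\<^sub>R ?Q p"
      using AE_f_neq
    proof eventually_elim
      case (elim p)
      have "cutoff \<longlonglongrightarrow> 0" using cutoff(3) by (simp add: filterlim_at)
      then have "\<forall>\<^sub>F n in sequentially. cutoff n < \<bar>f (fst p) - f (snd p)\<bar>"
        using elim by (intro order_tendstoD) auto
      then have "\<forall>\<^sub>F n in sequentially. ?R n p = w p *\<^sub>R ?Q p"
        by (rule eventually_mono) simp
      then show ?case by (rule tendsto_eventually)
    qed
    show "AE p in \<kappa> \<Otimes>\<^sub>M \<kappa>. norm (?R n p) \<le> K * ((1 / Im z) * (1 / Im z) * (1 / Im z + 1 / Im z))" for n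
    proof (rule AE_I2)
      fix p
      have "\<bar>w p * (if cutoff n < \<bar>f (fst p) - f (snd p)\<bar> then 1 else 0)\<bar> \<le> K"
        using w_abs_le[of p] K_nonneg by simp
      then show "norm (?R n p) \<le> K * ((1 / Im z) * (1 / Im z) * (1 / Im z + 1 / Im z))"
        unfolding norm_scaleR using K_nonneg Qb[of p] by (intro mult_mono) auto
    qed
  qed (auto simp: case_prod_beta')
  ultimately have 1: "(LINT x|\<kappa>. Ht (f x) *\<^sub>R (g x)\<^sup>2) = (LINT p|(\<kappa> \<Otimes>\<^sub>M \<kappa>). w p *\<^sub>R ?Q p) / 2"
    using LIMSEQ_unique by fastforce
  \<comment> \<open>\<open>?Q\<close> is the sum of \<open>g(s)\<^sup>2 g(t)\<close> and
    \<open>g(s) g(t)\<^sup>2\<close>, whose integrals against the symmetric weight agree.\<close>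
  let ?G1 = "\<lambda>p. w p *\<^sub>R (g (snd p) * (g (fst p))\<^sup>2)" and ?G2 = "\<lambda>p. w p *\<^sub>R (g (fst p) * (g (snd p))\<^sup>2)"
  have b: "cmod (w p *\<^sub>R (g x * (g y)\<^sup>2)) \<le> K * ((1 / Im z) * (1 / Im z)\<^sup>2)" for p x y
    unfolding norm_scaleR norm_mult using w_abs_le gb gb2 K_nonneg z by (intro mult_mono) auto
  have i1: "integrable (\<kappa> \<Otimes>\<^sub>M \<kappa>) ?G1" by (rule pair_integrable[OF _ b]) measurable
  have i2: "integrable (\<kappa> \<Otimes>\<^sub>M \<kappa>) ?G2" by (rule pair_integrable[OF _ b]) measurable
  have "(LINT p|(\<kappa> \<Otimes>\<^sub>M \<kappa>). ?G2 p) = (LINT p|(\<kappa> \<Otimes>\<^sub>M \<kappa>). ?G2 (snd p, fst p))"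
    by (rule pair_integral_swap[symmetric]) measurable
  also have "\<dots> = (LINT p|(\<kappa> \<Otimes>\<^sub>M \<kappa>). ?G1 p)"
  proof (rule integral_cong_AE)
    have [measurable]: "(\<lambda>p. w (snd p, fst p)) \<in> borel_measurable (\<kappa> \<Otimes>\<^sub>M \<kappa>)" by measurable
    show "(\<lambda>p. ?G2 (snd p, fst p)) \<in> borel_measurable (\<kappa> \<Otimes>\<^sub>M \<kappa>)" by simp
    show "AE p in \<kappa> \<Otimes>\<^sub>M \<kappa>. ?G2 (snd p, fst p) = ?G1 p"
      using AE_w_swap by eventually_elim simp
  qed measurable
  finally have 2: "(LINT p|(\<kappa> \<Otimes>\<^sub>M \<kappa>). ?G2 p) = (LINT p|(\<kappa> \<Otimes>\<^sub>M \<kappa>). ?G1 p)" .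
  have "(LINT p|(\<kappa> \<Otimes>\<^sub>M \<kappa>). w p *\<^sub>R ?Q p) = (LINT p|(\<kappa> \<Otimes>\<^sub>M \<kappa>). ?G1 p + ?G2 p)"
    by (intro Bochner_Integration.integral_cong)
       (simp_all add: power2_eq_square algebra_simps)
  also have "\<dots> = 2 * (LINT p|(\<kappa> \<Otimes>\<^sub>M \<kappa>). ?G1 p)" using i1 i2 2 by simp
  also have "(LINT p|(\<kappa> \<Otimes>\<^sub>M \<kappa>). ?G1 p) = (LINT x|\<kappa>. LINT y|\<kappa>. ?G1 (x, y))"
    by (rule unit2.integral_fst'[OF i1, symmetric])
  also have "\<dots> = second_order z"
    unfolding second_order_def g_def[symmetric]
    by (intro Bochner_Integration.integral_cong refl)
       (simp add: scaleR_conv_of_real mult.assoc[symmetric])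
  finally show ?thesis using 1 unfolding g_def by simp
qed

text \<open>The minus sign is the one in \<open>first_order_term\<close>; apart from it, the
  integral is pulled back along \<open>f\<close> with \<open>Ht\<close> as the real factor.\<close>

lemma first_order_integral:
  assumes z: "Im z > 0"
  shows "(LINT s|lebesgue. vector_derivative (cauchy_kernel z) (at s) * complex_of_real (first_order_term \<rho> \<tau> s)) = - second_order z"
proof -
  have "(LINT s|lebesgue. vector_derivative (cauchy_kernel z) (at s) * complex_of_real (first_order_term \<rho> \<tau> s)) =
      (LINT s|lebesgue. - ((\<rho> s * Ht s) *\<^sub>R (cauchy_kernel z s)\<^sup>2))"
    by (intro Bochner_Integration.integral_cong refl)
       (simp add: vector_derivative_at[OF cauchy_kernel_vector_derivative[OF z]] first_order_term_def scaleR_conv_of_real)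
  also have "\<dots> = - (LINT s|lebesgue. (\<rho> s * Ht s) *\<^sub>R (cauchy_kernel z s)\<^sup>2)" by simp
  also have "(LINT s|lebesgue. (\<rho> s * Ht s) *\<^sub>R (cauchy_kernel z s)\<^sup>2) =
      (LINT x|\<kappa>. Ht (f x) *\<^sub>R (cauchy_kernel z (f x))\<^sup>2)"
    by (intro pullback_integral) measurable
  finally show ?thesis by (simp add: Ht_integral_eq_second_order[OF z])
qed

end

section \<open>Functions of bounded variation\<close>

lemma has_bounded_variation_uminus:
  "has_bounded_variation G \<Longrightarrow> has_bounded_variation (\<lambda>s. - G s)"
  unfolding has_bounded_variation_def by (simp add: abs_minus_commute)

text \<open>It names the set whose supremum defines \<open>positive_variation\<close>.\<close>

definition positive_variation_sums :: "(real \<Rightarrow> real) \<Rightarrow> real \<Rightarrow> real set" where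
  "positive_variation_sums G s =
     {\<Sum>i<m. max 0 (G (x (Suc i)) - G (x i)) | (x :: nat \<Rightarrow> real) m. mono x \<and> x m \<le> s}"

text \<open>Positive parts of increments are at most their absolute values, so the total variation
  bounds every sum, uniformly in \<open>s\<close>. Enlarging \<open>s\<close> admits more
  partitions, which gives monotonicity.\<close>

lemma positive_variation_bounds:
  assumes "has_bounded_variation G"
  obtains B where "\<And>s. 0 \<le> positive_variation G s"
    "\<And>s. positive_variation G s \<le> B" "mono (positive_variation G)"
    "\<And>s v. v \<in> positive_variation_sums G s \<Longrightarrow> v \<le> positive_variation G s"
proof -
  obtain B where B: "\<And>x m. mono x \<Longrightarrow> (\<Sum>i<m. \<bar>G (x (Suc i)) - G (x i)\<bar>) \<le> B"
    using assms unfolding has_bounded_variation_def by blast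
  have le: "v \<le> B" if "v \<in> positive_variation_sums G s" for v s
  proof -
    obtain x :: "nat \<Rightarrow> real" and m where v: "v = (\<Sum>i<m. max 0 (G (x (Suc i)) - G (x i)))" "mono x"
      using \<open>v \<in> _\<close> unfolding positive_variation_sums_def by auto
    have "v \<le> (\<Sum>i<m. \<bar>G (x (Suc i)) - G (x i)\<bar>)"
      unfolding v by (intro sum_mono) auto
    then show ?thesis using B[OF v(2), of m] by simp
  qed
  then have bdd: "bdd_above (positive_variation_sums G s)" for s by (rule bdd_aboveI)
  \<comment> \<open>The empty sum: a constant sequence with \<open>m = 0\<close>.\<close>
  have zero: "0 \<in> positive_variation_sums G s" for s
    unfolding positive_variation_sums_def
    by (rule CollectI, rule exI[of _ "\<lambda>_. s"], rule exI[of _ 0]) (simp add: mono_def)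
  have eq: "positive_variation G s = Sup (positive_variation_sums G s)" for s
    by (simp add: positive_variation_def positive_variation_sums_def)
  have upper: "v \<le> positive_variation G s" if "v \<in> positive_variation_sums G s" for v s
    unfolding eq by (rule cSup_upper[OF that bdd])
  show thesis
  proof (rule that[OF _ _ _ upper])
    show "0 \<le> positive_variation G s" for s by (rule upper[OF zero])
    show "positive_variation G s \<le> B" for s
      unfolding eq using zero[of s] le by (intro cSup_least) auto
    show "mono (positive_variation G)"
    proof
      fix s t :: real assume "s \<le> t"
      then have "positive_variation_sums G s \<subseteq> positive_variation_sums G t"
        unfolding positive_variation_sums_def by (auto intro: order_trans)
      then show "positive_variation G s \<le> positive_variation G t"
        unfolding eq using zero bdd by (intro cSup_subset_mono) auto
    qed
  qed
qed

text \<open>A partition is refined so that it starts at a zero of \<open>G\<close> and ends at \<open>s\<close>; for such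
  partitions the two sums of increments differ exactly by \<open>G s\<close>.\<close>

lemma positive_variation_le:
  assumes bv: "has_bounded_variation G" and zeros: "\<And>a. \<exists>x\<le>a. G x = 0"
  shows "positive_variation G s \<le> positive_variation (\<lambda>t. - G t) s + G s"
proof -
  have upper: "v \<le> positive_variation (\<lambda>t. - G t) s"
    if "v \<in> positive_variation_sums (\<lambda>t. - G t) s" for s v
    by (rule positive_variation_bounds[OF has_bounded_variation_uminus[OF bv]]) (use that in blast)
  have "v \<le> positive_variation (\<lambda>t. - G t) s + G s" if v: "v \<in> positive_variation_sums G s" for v
  proof -
    obtain x :: "nat \<Rightarrow> real" and m where x: "v = (\<Sum>i<m. max 0 (G (x (Suc i)) - G (x i)))" "mono x" "x m \<le> s"
      using v unfolding positive_variation_sums_def by auto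
    obtain a where a: "a \<le> x 0" "G a = 0" using zeros by auto
    \<comment> \<open>The zero \<open>a\<close> is put before the partition, and from index
      \<open>m + 2\<close> on the sequence stays at \<open>s\<close>.\<close>
    define y where "y i = (case i of 0 \<Rightarrow> a | Suc j \<Rightarrow> if j \<le> m then x j else s)" for i
    have y: "y 0 = a" "\<And>j. j \<le> m \<Longrightarrow> y (Suc j) = x j" "\<And>j. m < j \<Longrightarrow> y (Suc j) = s"
      by (auto simp: y_def)
    have "mono y"
    proof (rule incseq_SucI)
      fix i
      show "y i \<le> y (Suc i)"
      proof (cases i)
        case 0
        then show ?thesis using a y by simp
      next
        case (Suc j)
        consider "Suc j \<le> m" | "j = m" | "m < j" by linarith
        then show ?thesis
          by cases (use Suc y x(3) monoD[OF x(2), of j "Suc j"] in auto)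
      qed
    qed
    have split: "(\<Sum>i<Suc (Suc m). h (y (Suc i)) (y i)) = h (x 0) a + (\<Sum>i<m. h (x (Suc i)) (x i)) + h s (x m)"
      for h :: "real \<Rightarrow> real \<Rightarrow> real"
    proof -
      have "(\<Sum>i<Suc (Suc m). h (y (Suc i)) (y i)) =
          h (y (Suc 0)) (y 0) + (\<Sum>i<Suc m. h (y (Suc (Suc i))) (y (Suc i)))"
        by (rule sum.lessThan_Suc_shift)
      also have "(\<Sum>i<Suc m. h (y (Suc (Suc i))) (y (Suc i))) =
          (\<Sum>i<m. h (y (Suc (Suc i))) (y (Suc i))) + h (y (Suc (Suc m))) (y (Suc m))" by simp
      also have "(\<Sum>i<m. h (y (Suc (Suc i))) (y (Suc i))) = (\<Sum>i<m. h (x (Suc i)) (x i))"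
        by (intro sum.cong) (auto simp: y)
      finally show ?thesis by (simp add: y)
    qed
    have "v \<le> (\<Sum>i<Suc (Suc m). max 0 (G (y (Suc i)) - G (y i)))"
      unfolding split[of "\<lambda>p q. max 0 (G p - G q)"] x(1) by simp
    \<comment> \<open>Here \<open>max 0 u = max 0 (- u) + u\<close>, and the added increments
      telescope to \<open>G s - G a = G s\<close>.\<close>
    also have "\<dots> = (\<Sum>i<Suc (Suc m). max 0 (- G (y (Suc i)) - - G (y i)) + (G (y (Suc i)) - G (y i)))"
      by (intro sum.cong) auto
    also have "\<dots> = (\<Sum>i<Suc (Suc m). max 0 (- G (y (Suc i)) - - G (y i))) + (G (y (Suc (Suc m))) - G (y 0))"
      unfolding sum.distrib using sum_lessThan_telescope[of "\<lambda>i. G (y i)" "Suc (Suc m)"] by (simp only:)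
    also have "\<dots> = (\<Sum>i<Suc (Suc m). max 0 (- G (y (Suc i)) - - G (y i))) + G s"
      using a y by simp
    also have "(\<Sum>i<Suc (Suc m). max 0 (- G (y (Suc i)) - - G (y i))) \<le> positive_variation (\<lambda>t. - G t) s"
      by (rule upper, unfold positive_variation_sums_def, rule CollectI, intro exI conjI, rule refl)
         (use \<open>mono y\<close> y in auto)
    finally show ?thesis by simp
  qed
  moreover have "positive_variation_sums G s \<noteq> {}"
    unfolding positive_variation_sums_def
    by (auto intro!: exI[of _ "\<lambda>_. s"] simp: mono_def)
  ultimately show ?thesis
    unfolding positive_variation_def positive_variation_sums_def[symmetric] by (intro cSup_least) auto
qed

text \<open>The preceding inequality is applied to \<open>G\<close> and to \<open>- G\<close>. Zeros
  arbitrarily far to the left fix the additive constant of the Jordan decomposition.\<close>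

lemma positive_variation_diff:
  assumes bv: "has_bounded_variation G" and zeros: "\<And>a. \<exists>x\<le>a. G x = 0"
  shows "G s = positive_variation G s - positive_variation (\<lambda>t. - G t) s"
proof -
  have "positive_variation (\<lambda>t. - G t) s \<le> positive_variation (\<lambda>t. - (- G t)) s + - G s"
    using zeros by (intro positive_variation_le has_bounded_variation_uminus[OF bv]) simp
  then show ?thesis using positive_variation_le[OF assms, of s] by simp
qed

text \<open>The function \<open>R\<close> of right limits is monotone, right-continuous and at least
  \<open>P\<close>, and it equals \<open>P\<close> wherever \<open>P\<close> is continuous, that is,
  off a countable set. The constant \<open>c\<close> is its limit at minus infinity.\<close>

lemma stieltjes_measure_of_mono:
  fixes P :: "real \<Rightarrow> real"
  assumes mono: "mono P" and P: "\<And>s. 0 \<le> P s" "\<And>s. P s \<le> B"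
  defines "R \<equiv> \<lambda>s. Lim (at_right s) P"
  shows "mono R" "\<And>s. 0 \<le> R s" "\<And>s. R s \<le> B" "AE s in lborel. R s = P s"
    "finite_measure (interval_measure R)"
    "\<exists>c. \<forall>t. measure (interval_measure R) {..t} = R t - c"
proof -
  have lim: "(P \<longlongrightarrow> Inf (P ` {s<..})) (at_right s)" for s
  proof -
    have "(P \<longlongrightarrow> Inf (P ` ({s<..} \<inter> UNIV))) (at s within ({s<..} \<inter> UNIV))"
      using mono P by (intro Lim_right_bound[where K = 0]) (auto dest: monoD)
    then show ?thesis by simp
  qed
  have R: "R s = Inf (P ` {s<..})" for s
    unfolding R_def using lim by (intro tendsto_Lim) auto
  have bdd: "bdd_below (P ` A)" for A using P(1) by (intro bdd_belowI[of _ 0]) auto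
  have le: "R s \<le> P t" if "s < t" for s t
    unfolding R using that bdd by (intro cInf_lower) auto
  have ge: "P s \<le> R s" for s
    unfolding R using monoD[OF mono] by (intro cInf_greatest) (auto simp: less_imp_le)
  show mR: "mono R"
  proof
    fix s t :: real assume "s \<le> t"
    then show "R s \<le> R t" using le[of s t] ge[of t] by (cases "s = t") auto
  qed
  show R0: "0 \<le> R s" for s using ge[of s] P(1)[of s] by simp
  show RB: "R s \<le> B" for s using le[of s "s + 1"] P(2)[of "s + 1"] by simp
  have rc: "continuous (at_right s) R" for s
    unfolding continuous_within
  proof (rule order_tendstoI)
    fix l assume l: "l < R s"
    show "\<forall>\<^sub>F u in at_right s. l < R u"
      by (rule eventually_mono[OF eventually_at_right_less])
         (use l monoD[OF mR] in \<open>auto intro: less_le_trans less_imp_le\<close>)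
  next
    fix u assume "R s < u"
    then have "\<forall>\<^sub>F t in at_right s. P t < u"
      using lim[of s] by (intro order_tendstoD) (auto simp: R)
    then obtain t where t: "s < t" "P t < u"
      unfolding eventually_at_right_field using dense by meson
    have "\<forall>\<^sub>F v in at_right s. v < t"
      using t(1) by (intro eventually_at_rightI[of s t]) auto
    then show "\<forall>\<^sub>F v in at_right s. R v < u"
      by eventually_elim (use le t in force)
  qed
  have "R s = P s" if "isCont P s" for s
  proof -
    have "(P \<longlongrightarrow> P s) (at_right s)" using that by (auto simp: isCont_def intro: tendsto_mono[OF at_le])
    then show ?thesis unfolding R_def by (intro tendsto_Lim) auto
  qed
  moreover have "AE s in lborel. s \<notin> {a. \<not> isCont P a}"
    by (intro AE_not_in countable_imp_null_set_lborel mono_ctble_discont mono)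
  ultimately show "AE s in lborel. R s = P s" by auto
  \<comment> \<open>For a monotone function the infimum is the limit at minus infinity; it is finite
    since \<open>R\<close> is nonnegative.\<close>
  define c where "c = Inf (range R)"
  have bR: "bdd_below (range R)" using R0 by (intro bdd_belowI[of _ 0]) auto
  have ctends: "(\<lambda>n. R (- real n)) \<longlonglongrightarrow> c"
  proof (rule order_tendstoI)
    fix l assume "l < c"
    moreover have "c \<le> R x" for x unfolding c_def by (rule cInf_lower[OF _ bR]) simp
    ultimately show "\<forall>\<^sub>F n in sequentially. l < R (- real n)"
      by (intro always_eventually) (auto intro: less_le_trans)
  next
    fix u assume "c < u"
    then obtain x where x: "R x < u"
      unfolding c_def using cInf_lessD[of "range R" u] by auto
    obtain N :: nat where N: "- x \<le> real N" using real_arch_simple by auto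
    show "\<forall>\<^sub>F n in sequentially. R (- real n) < u"
      unfolding eventually_sequentially
    proof (intro exI[of _ N] allI impI)
      fix n assume "N \<le> n"
      then have "- real n \<le> x" using N by linarith
      then show "R (- real n) < u" using x monoD[OF mR, of "- real n" x] by simp
    qed
  qed
  have Ioc: "emeasure (interval_measure R) {a<..b} = ennreal (R b - R a)" if "a \<le> b" for a b
    using that mR rc by (intro emeasure_interval_measure_Ioc) (auto dest: monoD)
  \<comment> \<open>The half-line is the increasing union of the intervals from \<open>- n\<close>
    to \<open>t\<close>, whose masses are increments of \<open>R\<close>.\<close>
  have Iic: "emeasure (interval_measure R) {..t} = ennreal (R t - c)" for t
  proof (rule LIMSEQ_unique)
    have "(\<lambda>n. emeasure (interval_measure R) {- real n<..t}) \<longlonglongrightarrow> emeasure (interval_measure R) (\<Union>n. {- real n<..t})"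
      by (rule Lim_emeasure_incseq) (auto simp: incseq_def)
    moreover have "(\<Union>n. {- real n<..t}) = {..t}"
    proof -
      have "\<exists>n. - real n < y" for y using reals_Archimedean2[of "- y"] by (auto simp: minus_less_iff)
      then show ?thesis by auto
    qed
    ultimately show "(\<lambda>n. emeasure (interval_measure R) {- real n<..t}) \<longlonglongrightarrow> emeasure (interval_measure R) {..t}"
      by simp
    obtain N :: nat where N: "- t \<le> real N" using real_arch_simple by auto
    have "\<forall>\<^sub>F n in sequentially. ennreal (R t - R (- real n)) = emeasure (interval_measure R) {- real n<..t}"
      unfolding eventually_sequentially
      by (intro exI[of _ N] allI impI Ioc[symmetric]) (use N in linarith)
    moreover have "(\<lambda>n. ennreal (R t - R (- real n))) \<longlonglongrightarrow> ennreal (R t - c)"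
      by (intro tendsto_intros ctends)
    ultimately show "(\<lambda>n. emeasure (interval_measure R) {- real n<..t}) \<longlonglongrightarrow> ennreal (R t - c)"
      by (rule Lim_transform_eventually[rotated])
  qed
  have cle: "c \<le> R t" for t unfolding c_def by (rule cInf_lower[OF _ bR]) simp
  show "\<exists>c. \<forall>t. measure (interval_measure R) {..t} = R t - c"
    using Iic cle by (intro exI[of _ c]) (simp add: measure_def)
  show "finite_measure (interval_measure R)"
  proof
    have "(\<lambda>n. emeasure (interval_measure R) {..real n}) \<longlonglongrightarrow> emeasure (interval_measure R) (\<Union>n. {..real n})"
      by (rule Lim_emeasure_incseq) (auto simp: incseq_def)
    moreover have "(\<Union>n. {..real n}) = UNIV" using real_arch_simple by auto
    moreover have "emeasure (interval_measure R) {..real n} \<le> ennreal (B - c)" for n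
      unfolding Iic using RB by (intro ennreal_leI) simp
    ultimately have "emeasure (interval_measure R) UNIV \<le> ennreal (B - c)"
      by (intro LIMSEQ_le_const2[of _ _ "ennreal (B - c)"]) auto
    then show "emeasure (interval_measure R) (space (interval_measure R)) \<noteq> \<infinity>"
      by (auto simp: top_unique)
  qed
qed

section \<open>Integration by parts\<close>

text \<open>The fundamental theorem is used on the open half-line. The closed condition
  \<open>s \<le> t\<close>, which changes a null set only, makes \<open>{..t}\<close> appear when
  the order of integration is exchanged.\<close>

lemma integral_FTC_atLeast:
  fixes g g' :: "real \<Rightarrow> complex"
  assumes g: "\<And>t. (g has_vector_derivative g' t) (at t)" "\<And>t. isCont g' t"
    and int: "integrable lborel g'"
    and top: "(g \<longlongrightarrow> 0) at_top"
  shows "(LINT t|lborel. (if s \<le> t then g' t else 0)) = - g s"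
proof -
  have m[measurable]: "g' \<in> borel_measurable borel" using int by auto
  have "(LBINT t=ereal s..\<infinity>. g' t) = 0 - g s"
  proof (rule interval_integral_FTC_integrable)
    show "set_integrable lborel (einterval (ereal s) \<infinity>) g'"
      using int by (auto simp: set_integrable_def intro: integrable_mult_indicator)
    have "isCont g s" using g(1) has_vector_derivative_continuous by blast
    then show "((g \<circ> real_of_ereal) \<longlongrightarrow> g s) (at_right (ereal s))"
      by (auto simp: ereal_tendsto_simps isCont_def intro: tendsto_mono[OF at_le])
    show "((g \<circ> real_of_ereal) \<longlongrightarrow> 0) (at_left \<infinity>)"
      using top by (simp add: ereal_tendsto_simps)
  qed (use g in auto)
  also have "(LBINT t=ereal s..\<infinity>. g' t) = (LINT t|lborel. indicator {s<..} t *\<^sub>R g' t)"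
    by (simp add: interval_lebesgue_integral_def set_lebesgue_integral_def)
  also have "\<dots> = (LINT t|lborel. (if s \<le> t then g' t else 0))"
  proof (rule integral_cong_AE)
    show "AE t in lborel. indicator {s<..} t *\<^sub>R g' t = (if s \<le> t then g' t else 0)"
      using AE_lborel_singleton[of s] by eventually_elim (auto simp: indicator_def)
  qed measurable
  finally show ?thesis by simp
qed

text \<open>Each value \<open>g s\<close> is minus the integral of \<open>g'\<close> over
  \<open>t \<ge> s\<close>. By Fubini the integration in \<open>s\<close> comes first and collects
  the mass of \<open>{..t}\<close>.\<close>

lemma integral_by_parts_finite_measure:
  fixes g g' :: "real \<Rightarrow> complex"
  assumes "finite_measure \<nu>" and sets[measurable_cong]: "sets \<nu> = sets borel"
    and g: "\<And>t. (g has_vector_derivative g' t) (at t)" "\<And>t. isCont g' t"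
    and int: "integrable lborel g'"
    and top: "(g \<longlongrightarrow> 0) at_top"
  shows "(LINT s|\<nu>. g s) = - (LINT t|lborel. measure \<nu> {..t} *\<^sub>R g' t)"
proof -
  interpret \<nu>: finite_measure \<nu> by fact
  interpret pair_sigma_finite \<nu> lborel ..
  have m[measurable]: "g' \<in> borel_measurable borel" using int by auto
  let ?h = "\<lambda>(s, t). if s \<le> t then g' t else 0"
  have hm[measurable]: "?h \<in> borel_measurable (\<nu> \<Otimes>\<^sub>M lborel)" by measurable
  have hm2: "(\<lambda>t. if s \<le> t then g' t else 0) \<in> borel_measurable lborel" for s :: real by measurable
  have i1: "integrable lborel (\<lambda>t. if s \<le> t then g' t else 0)" for s
    by (rule Bochner_Integration.integrable_bound[OF int hm2]) auto
  have hint: "integrable (\<nu> \<Otimes>\<^sub>M lborel) ?h"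
  proof (rule Fubini_integrable[OF hm])
    show "integrable \<nu> (\<lambda>s. LINT t|lborel. norm (?h (s, t)))"
    proof (rule \<nu>.integrable_const_bound[where B = "LINT t|lborel. norm (g' t)"])
      show "AE s in \<nu>. norm (LINT t|lborel. norm (?h (s, t))) \<le> (LINT t|lborel. norm (g' t))"
      proof (rule AE_I2)
        fix s
        have "(LINT t|lborel. norm (?h (s, t))) \<le> (LINT t|lborel. norm (g' t))"
          using i1[of s] int by (intro integral_mono integrable_norm) auto
        then show "norm (LINT t|lborel. norm (?h (s, t))) \<le> (LINT t|lborel. norm (g' t))"
          by simp
      qed
    qed measurable
    show "AE s in \<nu>. integrable lborel (\<lambda>t. ?h (s, t))" using i1 by simp
  qed
  have "(LINT s|\<nu>. g s) = - (LINT s|\<nu>. LINT t|lborel. (if s \<le> t then g' t else 0))"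
    unfolding integral_FTC_atLeast[OF g int top] by simp
  also have "(LINT s|\<nu>. LINT t|lborel. (if s \<le> t then g' t else 0)) =
      (LINT t|lborel. LINT s|\<nu>. (if s \<le> t then g' t else 0))"
    by (rule Fubini_integral[symmetric]) (use hint in simp)
  also have "\<dots> = (LINT t|lborel. measure \<nu> {..t} *\<^sub>R g' t)"
  proof (intro Bochner_Integration.integral_cong refl)
    fix t
    have "(LINT s|\<nu>. (if s \<le> t then g' t else 0)) = (LINT s|\<nu>. indicator {..t} s *\<^sub>R g' t)"
      by (intro Bochner_Integration.integral_cong) (auto simp: indicator_def)
    also have "\<dots> = measure \<nu> {..t} *\<^sub>R g' t"
      using sets_eq_imp_space_eq[OF sets] by (subst integral_scaleR_left) (auto simp: sets less_top[symmetric])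
    finally show "(LINT s|\<nu>. (if s \<le> t then g' t else 0)) = measure \<nu> {..t} *\<^sub>R g' t" .
  qed
  finally show ?thesis .
qed

text \<open>\<open>G\<close> is the difference of its two variations, each of which is integrated by
  parts against its own Stieltjes measure. As a difference of monotone functions \<open>G\<close> is
  Borel.\<close>

lemma stieltjes_integral_by_parts:
  fixes g g' :: "real \<Rightarrow> complex"
  assumes bv: "has_bounded_variation G" and zeros: "\<And>a. \<exists>x\<le>a. G x = 0"
    and g: "\<And>t. (g has_vector_derivative g' t) (at t)" "\<And>t. isCont g' t"
    and int: "integrable lborel g'"
    and top: "(g \<longlongrightarrow> 0) at_top" and bot: "(g \<longlongrightarrow> 0) at_bot"
  shows "stieltjes_integral G g = - (LINT t|lborel. G t *\<^sub>R g' t)" "G \<in> borel_measurable borel"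
proof -
  have m[measurable]: "g' \<in> borel_measurable borel" using int by auto
  \<comment> \<open>This uses that \<open>g\<close> vanishes at both ends. It removes the constant
    by which the distribution function of a Stieltjes measure differs from the generating
    function.\<close>
  have zero: "(LINT t|lborel. g' t) = 0"
  proof -
    have "(LBINT t=-\<infinity>..\<infinity>. g' t) = 0 - 0"
    proof (rule interval_integral_FTC_integrable)
      show "set_integrable lborel (einterval (-\<infinity>) \<infinity>) g'"
        using int by (simp add: set_integrable_def)
    qed (use g top bot in \<open>auto simp: ereal_tendsto_simps\<close>)
    then show ?thesis by (simp add: interval_lebesgue_integral_def set_lebesgue_integral_def)
  qed
  have part: "(LINT s|positive_stieltjes_measure H. g s) = - (LINT t|lborel. positive_variation H t *\<^sub>R g' t) \<and>
      integrable lborel (\<lambda>t. positive_variation H t *\<^sub>R g' t) \<and> positive_variation H \<in> borel_measurable borel"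
    if H: "has_bounded_variation H" for H
  proof -
    let ?P = "positive_variation H" and ?R = "\<lambda>s. Lim (at_right s) (positive_variation H)"
    obtain B where P: "\<And>s. 0 \<le> ?P s" "\<And>s. ?P s \<le> B" "mono ?P"
      using positive_variation_bounds[OF H] by metis
    note st = stieltjes_measure_of_mono[OF P(3) P(1,2)]
    obtain c where c: "\<And>t. measure (interval_measure ?R) {..t} = ?R t - c" using st(6) by auto
    have Rm[measurable]: "?R \<in> borel_measurable borel" using st(1) by (rule borel_measurable_mono)
    have Pm[measurable]: "?P \<in> borel_measurable borel" using P(3) by (rule borel_measurable_mono)
    have bound: "integrable lborel (\<lambda>t. Q t *\<^sub>R g' t)"
      if [measurable]: "Q \<in> borel_measurable borel" and Q: "\<And>t. 0 \<le> Q t" "\<And>t. Q t \<le> B" for Q :: "real \<Rightarrow> real"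
    proof (rule Bochner_Integration.integrable_bound)
      show "integrable lborel (\<lambda>t. B *\<^sub>R g' t)" using int by simp
      have "\<bar>Q t\<bar> \<le> \<bar>B\<bar>" for t using Q[of t] by simp
      then show "AE t in lborel. norm (Q t *\<^sub>R g' t) \<le> norm (B *\<^sub>R g' t)"
        by (auto intro!: mult_right_mono)
    qed measurable
    have "(LINT s|positive_stieltjes_measure H. g s) = - (LINT t|lborel. (?R t - c) *\<^sub>R g' t)"
      unfolding positive_stieltjes_measure_def c[symmetric]
      by (rule integral_by_parts_finite_measure[OF st(5) _ g int top]) simp
    also have "(LINT t|lborel. (?R t - c) *\<^sub>R g' t) = (LINT t|lborel. ?R t *\<^sub>R g' t) - c *\<^sub>R (LINT t|lborel. g' t)"
      using bound[OF Rm st(2,3)] int by (simp add: scaleR_diff_left)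
    also have "\<dots> = (LINT t|lborel. ?R t *\<^sub>R g' t)" by (simp add: zero)
    \<comment> \<open>Right limits were needed for the measure only; under Lebesgue measure they may
      be undone.\<close>
    also have "\<dots> = (LINT t|lborel. ?P t *\<^sub>R g' t)"
    proof (rule integral_cong_AE)
      show "AE t in lborel. ?R t *\<^sub>R g' t = ?P t *\<^sub>R g' t" using st(4) by eventually_elim simp
    qed measurable
    finally show ?thesis using bound[OF Pm P(1,2)] Pm by simp
  qed
  note p = part[OF bv] and n = part[OF has_bounded_variation_uminus[OF bv]]
  have eq: "G = (\<lambda>t. positive_variation G t - positive_variation (\<lambda>t. - G t) t)"
    using positive_variation_diff[OF bv zeros] by (rule ext)
  have "(\<lambda>t. positive_variation G t - positive_variation (\<lambda>t. - G t) t) \<in> borel_measurable borel"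
    using p n by (intro borel_measurable_diff) auto
  then show "G \<in> borel_measurable borel" by (simp only: eq[symmetric])
  have "(LINT t|lborel. G t *\<^sub>R g' t) =
      (LINT t|lborel. positive_variation G t *\<^sub>R g' t - positive_variation (\<lambda>t. - G t) t *\<^sub>R g' t)"
  proof (intro Bochner_Integration.integral_cong refl)
    fix t
    have "G t *\<^sub>R g' t = (positive_variation G t - positive_variation (\<lambda>t. - G t) t) *\<^sub>R g' t"
      by (rule arg_cong[where f = "\<lambda>u. u *\<^sub>R g' t"], rule positive_variation_diff[OF bv zeros])
    then show "G t *\<^sub>R g' t = positive_variation G t *\<^sub>R g' t - positive_variation (\<lambda>t. - G t) t *\<^sub>R g' t"
      by (simp only: scaleR_diff_left)
  qed
  then show "stieltjes_integral G g = - (LINT t|lborel. G t *\<^sub>R g' t)"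
    using p n by (simp add: stieltjes_integral_def)
qed

section \<open>The expansion of the limit law\<close>

text \<open>Boundedness of \<open>f\<close> makes the density, hence \<open>G\<close>, vanish almost
  everywhere far to the left. This supplies the zeros required for integration by parts.\<close>

lemma (in Hoelder_profile) stieltjes_integral_first_order:
  assumes bounded_f: "bounded (f ` {0..1})" and bv: "has_bounded_variation G"
    and G: "AE s in lborel. G s = first_order_term \<rho> \<tau> s" and z: "Im z > 0"
  shows "(LINT s|lebesgue. vector_derivative (cauchy_kernel z) (at s) * complex_of_real (first_order_term \<rho> \<tau> s))
     = - stieltjes_integral G (cauchy_kernel z)"
proof -
  let ?g' = "\<lambda>t. (cauchy_kernel z t)\<^sup>2"
  obtain B where B: "\<And>x. x \<in> {0..1} \<Longrightarrow> \<bar>f x\<bar> \<le> B"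
    using bounded_f unfolding bounded_iff real_norm_def by blast
  have "AE t in lborel. t \<in> {..<- B} \<longrightarrow> \<rho> t = 0"
    by (rule AE_\<rho>_eq_0) (use B in force)+
  with G have "AE t in lborel. t < - B \<longrightarrow> G t = 0"
    by eventually_elim (simp add: first_order_term_def)
  note vanish = this
  \<comment> \<open>The point is sought below \<open>- B - 1\<close>, so that it lies strictly to
    the left of \<open>- B\<close>.\<close>
  have zeros: "\<exists>t\<le>a. G t = 0" for a
  proof -
    obtain t where "t \<le> min a (- B - 1)" "t < - B \<longrightarrow> G t = 0"
      using AE_lborel_ex_le[OF vanish] by blast
    then show ?thesis by (intro exI[of _ t]) auto
  qed
  have cont: "isCont ?g' t" for t
    using has_vector_derivative_continuous[OF cauchy_kernel_vector_derivative[OF z]]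
    by (intro continuous_power)
  note by_parts = stieltjes_integral_by_parts[OF bv zeros cauchy_kernel_vector_derivative[OF z] cont
      cauchy_kernel_square_integrable[OF z] cauchy_kernel_tendsto_0]
  have Gm[measurable]: "G \<in> borel_measurable borel" by (rule by_parts(2))
  have "(LINT s|lebesgue. vector_derivative (cauchy_kernel z) (at s) * complex_of_real (first_order_term \<rho> \<tau> s)) =
      (LINT s|lebesgue. first_order_term \<rho> \<tau> s *\<^sub>R ?g' s)"
    by (intro Bochner_Integration.integral_cong refl)
       (simp add: vector_derivative_at[OF cauchy_kernel_vector_derivative[OF z]] scaleR_conv_of_real)
  also have "\<dots> = (LINT s|lebesgue. G s *\<^sub>R ?g' s)"
  proof (rule integral_cong_AE)
    have [measurable]: "?g' \<in> borel_measurable lebesgue" "G \<in> borel_measurable lebesgue"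
      by (intro measurable_completion; simp)+
    note [measurable] = first_order_term_measurable
    show "(\<lambda>s. first_order_term \<rho> \<tau> s *\<^sub>R ?g' s) \<in> borel_measurable lebesgue"
      "(\<lambda>s. G s *\<^sub>R ?g' s) \<in> borel_measurable lebesgue" by measurable
    show "AE s in lebesgue. first_order_term \<rho> \<tau> s *\<^sub>R ?g' s = G s *\<^sub>R ?g' s"
      using AE_completion[OF G] by eventually_elim simp
  qed
  also have "\<dots> = (LINT s|lborel. G s *\<^sub>R ?g' s)"
    by (intro integral_completion) simp
  finally show ?thesis by (simp add: by_parts(1))
qed

text \<open>Bounded variation is asked of a representative \<open>G\<close>, since the first order
  term is meaningful up to null sets only; \<open>G\<close> may be that term itself. The limit is
  one-sided because \<open>\<epsilon>\<close> is a variance scale.\<close>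

theorem theorem1:
  fixes M :: "nat \<Rightarrow> 'w measure"
    and X :: "nat \<Rightarrow> nat \<Rightarrow> nat \<Rightarrow> 'w \<Rightarrow> complex"
    and var :: "nat \<Rightarrow> nat \<Rightarrow> nat \<Rightarrow> real"
    and a :: "nat \<Rightarrow> nat \<Rightarrow> real"
    and \<sigma> \<tau> :: "real \<Rightarrow> real \<Rightarrow> real"
    and f \<rho> :: "real \<Rightarrow> real"
    and \<mu> :: "real measure"
    and \<mu>\<^sub>\<epsilon> :: "real \<Rightarrow> real measure"
    and \<eta>\<^sub>0 \<alpha> C :: real
  assumes gaussian: "\<And>n. n \<ge> 1 \<Longrightarrow> gaussian_hermitian (M n) n (X n) (var n)"
    and bounded_\<sigma>: "bounded ((\<lambda>(x, y). \<sigma> x y) ` ({0..1} \<times> {0..1}))"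
    and bounded_f: "bounded (f ` {0..1})"
    and lim_var: "profile_converges2 var (\<lambda>x y. (\<sigma> x y)\<^sup>2)"
    and lim_a: "profile_converges1 a f"
    and disc_closed: "closed (discontinuities \<sigma>)"
    and disc_finite: "\<And>x. x \<in> {0..1} \<Longrightarrow> finite {y. (x, y) \<in> discontinuities \<sigma>}"
    and \<mu>_def: "\<mu> = distr (lebesgue_on {0..1}) borel f"
    and \<rho>_nonneg: "\<And>t. 0 \<le> \<rho> t"
    and density: "distributed (lebesgue_on {0..1}) lborel f (\<lambda>t. ennreal (\<rho> t))"
    and \<tau>_sym: "\<And>s t. \<tau> s t = \<tau> t s"
    and \<tau>: "\<And>x y. x \<in> {0..1} \<Longrightarrow> y \<in> {0..1} \<Longrightarrow> (\<sigma> x y)\<^sup>2 = \<tau> (f x) (f y)"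
    and \<eta>\<^sub>0_pos: "\<eta>\<^sub>0 > 0"
    and \<alpha>_pos: "\<alpha> > 0"
    and hoelder: "AE s in lborel. \<forall>t\<in>{s - \<eta>\<^sub>0..s + \<eta>\<^sub>0}.
           \<bar>\<tau> s t * \<rho> t - \<tau> s s * \<rho> s\<bar> \<le> C * \<bar>t - s\<bar> powr \<alpha>"
    and limit_law: "\<And>\<epsilon>. \<epsilon> \<ge> 0 \<Longrightarrow> real_distribution (\<mu>\<^sub>\<epsilon> \<epsilon>) \<and>
           tends_weakly_in_prob M
             (\<lambda>n \<omega>. spectral_distribution (perturbed_matrix n (a n) (\<lambda>i j. X n i j \<omega>) \<epsilon>)) (\<mu>\<^sub>\<epsilon> \<epsilon>)"
    and shlyakhtenko: "\<And>\<epsilon>. \<epsilon> \<ge> 0 \<Longrightarrow> has_shlyakhtenko_transform \<sigma> f \<epsilon> (\<mu>\<^sub>\<epsilon> \<epsilon>)"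
  shows "(\<forall>z. Im z > 0 \<longrightarrow>
            (\<lambda>\<epsilon>. (LINT s|\<mu>\<^sub>\<epsilon> \<epsilon>. cauchy_kernel z s)
                 - ((LINT s|\<mu>. cauchy_kernel z s)
                    - complex_of_real \<epsilon> *
                      (LINT s|lebesgue. vector_derivative (cauchy_kernel z) (at s)
                                 * complex_of_real (first_order_term \<rho> \<tau> s))))
              \<in> o[at_right 0](\<lambda>\<epsilon>. complex_of_real \<epsilon>)) \<and>
         (\<forall>G. has_bounded_variation G \<and> (AE s in lborel. G s = first_order_term \<rho> \<tau> s) \<longrightarrow>
            (\<forall>z. Im z > 0 \<longrightarrow>
              (\<lambda>\<epsilon>. (LINT s|\<mu>\<^sub>\<epsilon> \<epsilon>. cauchy_kernel z s)
                   - ((LINT s|\<mu>. cauchy_kernel z s)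
                      + complex_of_real \<epsilon> * stieltjes_integral G (cauchy_kernel z)))
                \<in> o[at_right 0](\<lambda>\<epsilon>. complex_of_real \<epsilon>)))"
proof -
  obtain B where B: "\<And>x y. x \<in> {0..1} \<Longrightarrow> y \<in> {0..1} \<Longrightarrow> \<bar>\<sigma> x y\<bar> \<le> B"
    using bounded_\<sigma> unfolding bounded_iff real_norm_def by fast
  \<comment> \<open>The profile bound \<open>K\<close> of the locale is taken to be
    \<open>B\<^sup>2\<close>.\<close>
  have "(\<sigma> x y)\<^sup>2 \<le> B\<^sup>2" if "x \<in> {0..1}" "y \<in> {0..1}" for x y
    using power_mono[OF B[OF that], of 2] by simp
  then interpret Hoelder_profile f \<rho> \<sigma> \<tau> "B\<^sup>2" \<eta>\<^sub>0 \<alpha> C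
    using \<rho>_nonneg density disc_closed disc_finite \<tau>_sym \<tau> \<eta>\<^sub>0_pos \<alpha>_pos hoelder
    by unfold_locales
  have \<mu>: "(LINT s|\<mu>. cauchy_kernel z s) = (LINT x|\<kappa>. cauchy_kernel z (f x))" for z
    unfolding \<mu>_def by (rule integral_distr) measurable
  let ?I = "\<lambda>z. LINT s|lebesgue. vector_derivative (cauchy_kernel z) (at s) * complex_of_real (first_order_term \<rho> \<tau> s)"
  \<comment> \<open>The coefficient of \<open>\<epsilon>\<close> in the expansion equals
    \<open>- ?I z\<close>, and the quadratic error has a constant independent of
    \<open>\<epsilon>\<close>.\<close>
  have first: "(\<lambda>\<epsilon>. (LINT s|\<mu>\<^sub>\<epsilon> \<epsilon>. cauchy_kernel z s) - ((LINT s|\<mu>. cauchy_kernel z s) - complex_of_real \<epsilon> * ?I z))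
      \<in> o[at_right 0](\<lambda>\<epsilon>. complex_of_real \<epsilon>)" if z: "Im z > 0" for z
  proof (rule smallo_of_quadratic_bound)
    fix \<epsilon> :: real assume \<epsilon>: "0 < \<epsilon>"
    then show "cmod ((LINT s|\<mu>\<^sub>\<epsilon> \<epsilon>. cauchy_kernel z s) - ((LINT s|\<mu>. cauchy_kernel z s) - complex_of_real \<epsilon> * ?I z))
        \<le> 2 * (B\<^sup>2)\<^sup>2 / (Im z)^5 * \<epsilon>\<^sup>2"
      using transform_expansion[OF shlyakhtenko[OF less_imp_le] \<epsilon> z]
      by (simp only: first_order_integral[OF z] \<mu> mult_minus_right diff_minus_eq_add diff_diff_add)
  qed
  have second: "(\<lambda>\<epsilon>. (LINT s|\<mu>\<^sub>\<epsilon> \<epsilon>. cauchy_kernel z s) - ((LINT s|\<mu>. cauchy_kernel z s)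
        + complex_of_real \<epsilon> * stieltjes_integral G (cauchy_kernel z)))
      \<in> o[at_right 0](\<lambda>\<epsilon>. complex_of_real \<epsilon>)"
    if "has_bounded_variation G" "AE s in lborel. G s = first_order_term \<rho> \<tau> s" "Im z > 0" for G z
    using first[OF that(3)]
    by (simp only: stieltjes_integral_first_order[OF bounded_f that] mult_minus_right diff_minus_eq_add)
  show ?thesis using first second by blast
qed

end
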